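(* (i) There exists an absolute constant $C>0$ such that, for every $d\in(0,\pi]$ and every $q=\psi'+\psi^2$ with $\psi\in\mathcal A(I_\pi)$ and $\mathrm{dom}(\psi)=I_d$, $$\lambda_1(I_d,q)\ge 3+C(\pi-d)^3.$$ (ii) There exists an absolute constant $K>0$ such that the following holds. Let $d\in(0,\pi]$, let $m\in\mathbb{N}\setminus\{0\}$, and let $q=\psi'+\psi^2$ with $\psi\in\mathcal A(I_\pi)$ of the form $\psi=f+\frac g2$, where $f\in\mathcal A(I_\pi)$ with $\mathrm{dom}(f)=I_d$, and $g=-(\log h)'$ on $I_d$ for some positive $\frac1m$-concave function $h$ on $I_d$ which is affine on an interval $[a,b]$ with $I_{\pi/4}\subseteq[a,b]\subseteq I_d$. Then $$\lambda_1(I_d,q)\le 7\ \Longrightarrow\ \lambda_1(I_d,q)\ge 3+\frac{8K}{m\pi^2}\Big[1-\frac{\min\{h(a),h(b)\}}{\max\{h(a),h(b)\}}\Big]^2 .$$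
   Context: For $\ell>0$, $I_\ell:=(-\frac{\ell}{2},\frac{\ell}{2})$; in particular $I_\pi=(-\frac\pi2,\frac\pi2)$. For an open bounded interval $I$ and a nonnegative Borel measure $q$ on $I$, possibly taking the value $+\infty$, $$\lambda_1(I,q):=\inf\Big\{\frac{\int_I|v'|^2dx+\int_I|v|^2\,dq}{\int_I v^2dx}: v\in H^1_0(I)\cap L^2(I,q),\ v\neq0\Big\}.$$ $\mathcal A(I_\pi)$ is the class of increasing functions $\psi:I_\pi\to\mathbb{R}\cup\{\pm\infty\}$, with finiteness domain $\mathrm{dom}(\psi)=\{x\in I_\pi:\psi(x)\in\mathbb{R}\}$, such that $\psi(y)-\psi(x)\ge 2\tan\big(\frac{y-x}{2}\big)$ whenever $x<y$ belong to $\mathrm{dom}(\psi)$. $\psi'$ denotes the distributional derivative of $\psi$ on $\mathrm{dom}(\psi)$ (a nonnegative measure) and $\psi^2$ denotes the measure $\psi^2\,dx$; both are extended to $+\infty$ on $I_\pi\setminus\mathrm{dom}(\psi)$. For $d<\pi$ the eigenvalue $\lambda_1(I_d,q)$ is identified with $\lambda_1(I_\pi,\tilde q)$, where $\tilde q$ is the extension of $q$ by $+\infty$ on $I_\pi\setminus I_d$. A positive function $h$ is $\frac1m$-concave if $h^{1/m}$ is concave. *)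

theory Defs
  imports "HOL-Analysis.Analysis"
begin

definition Iv :: "real \<Rightarrow> real set" where
  "Iv l = {- l / 2 <..< l / 2}"

text \<open>\<open>C\<^sub>c\<^sup>\<infinity>(U)\<close>, each function being extended by zero to the whole line.\<close>

definition test_fun :: "real set \<Rightarrow> (real \<Rightarrow> real) set" where
  "test_fun U = {\<phi>. (\<forall>k x. ((deriv ^^ k) \<phi>) differentiable (at x)) \<and>
                     (\<exists>K. compact K \<and> K \<subseteq> U \<and> (\<forall>x. x \<notin> K \<longrightarrow> \<phi> x = 0))}"

definition L2_on :: "real set \<Rightarrow> (real \<Rightarrow> real) \<Rightarrow> bool" where
  "L2_on U v \<longleftrightarrow> set_borel_measurable lborel U v \<and> set_integrable lborel U (\<lambda>x. (v x)\<^sup>2)"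

definition has_weak_deriv :: "real set \<Rightarrow> (real \<Rightarrow> real) \<Rightarrow> (real \<Rightarrow> real) \<Rightarrow> bool" where
  "has_weak_deriv U v w \<longleftrightarrow>
     (\<forall>\<phi>\<in>test_fun U.
        set_integrable lborel U (\<lambda>x. v x * deriv \<phi> x) \<and>
        set_integrable lborel U (\<lambda>x. w x * \<phi> x) \<and>
        (LINT x:U|lborel. v x * deriv \<phi> x) = - (LINT x:U|lborel. w x * \<phi> x))"

text \<open>
  \<open>H10 I v w\<close>: \<open>v\<close> is the continuous representative of an element of \<open>H\<^sup>1\<^sub>0(I)\<close>, the closure of
  \<open>C\<^sub>c\<^sup>\<infinity>(I)\<close> in \<open>H\<^sup>1(I)\<close>, and \<open>w\<close> represents its weak derivative. The continuous representative
  is needed because \<open>v\<close> is integrated below against measures that may charge Lebesgue null sets.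
\<close>

definition H10 :: "real set \<Rightarrow> (real \<Rightarrow> real) \<Rightarrow> (real \<Rightarrow> real) \<Rightarrow> bool" where
  "H10 I v w \<longleftrightarrow>
     continuous_on I v \<and> L2_on I v \<and> L2_on I w \<and> has_weak_deriv I v w \<and>
     (\<exists>\<phi>. (\<forall>n. \<phi> n \<in> test_fun I) \<and>
          (\<lambda>n. LINT x:I|lborel. (\<phi> n x - v x)\<^sup>2 + (deriv (\<phi> n) x - w x)\<^sup>2) \<longlonglongrightarrow> 0)"

text \<open>
  The measure \<open>q\<close> may live on a larger space than \<open>I\<close>; only its restriction to \<open>I\<close> is used.
  The infimum is taken over pairs \<open>(v, v')\<close>, the second component being determined almost
  everywhere by the first.
\<close>

definition lambda1 :: "real set \<Rightarrow> real measure \<Rightarrow> ereal" where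
  "lambda1 I q =
     (INF (v, w) \<in> {(v, w). H10 I v w \<and> set_integrable q I (\<lambda>x. (v x)\<^sup>2) \<and> (\<exists>x\<in>I. v x \<noteq> 0)}.
        ereal (((LINT x:I|lborel. (w x)\<^sup>2) + (LINT x:I|q. (v x)\<^sup>2)) / (LINT x:I|lborel. (v x)\<^sup>2)))"

text \<open>Values outside \<open>Iv pi\<close> are irrelevant throughout.\<close>

definition fin_dom :: "(real \<Rightarrow> ereal) \<Rightarrow> real set" where
  "fin_dom \<psi> = {x \<in> Iv pi. \<bar>\<psi> x\<bar> \<noteq> \<infinity>}"

definition class_A :: "(real \<Rightarrow> ereal) set" where
  "class_A = {\<psi>. mono_on (Iv pi) \<psi> \<and>
     (\<forall>x\<in>fin_dom \<psi>. \<forall>y\<in>fin_dom \<psi>. x < y \<longrightarrow> \<psi> y - \<psi> x \<ge> ereal (2 * tan ((y - x) / 2)))}"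

text \<open>The nonnegative Borel measure \<open>\<mu>\<close> on the open set \<open>U\<close> is the distributional derivative
  of \<open>f\<close> on \<open>U\<close>. Integrability of all test functions makes \<open>\<mu>\<close> locally finite.\<close>

definition has_distr_deriv :: "real set \<Rightarrow> (real \<Rightarrow> real) \<Rightarrow> real measure \<Rightarrow> bool" where
  "has_distr_deriv U f \<mu> \<longleftrightarrow>
     sets \<mu> = sets (restrict_space borel U) \<and>
     (\<forall>\<phi>\<in>test_fun U.
        integrable \<mu> \<phi> \<and> set_integrable lborel U (\<lambda>x. f x * deriv \<phi> x) \<and>
        (LINT x:U|lborel. f x * deriv \<phi> x) = - (LINT x|\<mu>. \<phi> x))"

definition sq_measure :: "(real \<Rightarrow> ereal) \<Rightarrow> real measure" where
  "sq_measure \<psi> =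
     density (restrict_space lborel (fin_dom \<psi>)) (\<lambda>x. ennreal ((real_of_ereal (\<psi> x))\<^sup>2))"

text \<open>The measure \<open>\<mu> + \<psi>\<^sup>2 dx\<close> on \<open>fin_dom \<psi>\<close>, extended to \<open>Iv pi\<close> by giving infinite mass to
  every Borel set that meets the complement of \<open>fin_dom \<psi>\<close>.\<close>

definition ext_potential :: "(real \<Rightarrow> ereal) \<Rightarrow> real measure \<Rightarrow> real measure" where
  "ext_potential \<psi> \<mu> =
     measure_of (Iv pi) (sets (restrict_space borel (Iv pi)))
       (\<lambda>A. if A \<subseteq> fin_dom \<psi> then emeasure \<mu> A + emeasure (sq_measure \<psi>) A else \<infinity>)"

definition is_potential :: "(real \<Rightarrow> ereal) \<Rightarrow> real measure \<Rightarrow> bool" where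
  "is_potential \<psi> q \<longleftrightarrow>
     (\<exists>\<mu>. has_distr_deriv (fin_dom \<psi>) (\<lambda>x. real_of_ereal (\<psi> x)) \<mu> \<and> q = ext_potential \<psi> \<mu>)"

lemma sets_ext_potential: "sets (ext_potential \<psi> \<mu>) = sets (restrict_space borel (Iv pi))"
proof -
  have "space (restrict_space borel (Iv pi)) = Iv pi"
    by (simp add: space_restrict_space)
  then show ?thesis
    unfolding ext_potential_def
    by (metis sets.sets_measure_of_eq)
qed

text \<open>The set function above is indeed a measure, so \<^const>\<open>measure_of\<close> does not collapse to zero.\<close>

lemma emeasure_ext_potential:
  assumes \<mu>: "sets \<mu> = sets (restrict_space borel (fin_dom \<psi>))"
    and A: "A \<in> sets (restrict_space borel (Iv pi))"
  shows "emeasure (ext_potential \<psi> \<mu>) A =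
    (if A \<subseteq> fin_dom \<psi> then emeasure \<mu> A + emeasure (sq_measure \<psi>) A else \<infinity>)"
proof -
  let ?M = "restrict_space borel (Iv pi)"
  let ?f = "\<lambda>A. if A \<subseteq> fin_dom \<psi> then emeasure \<mu> A + emeasure (sq_measure \<psi>) A else \<infinity>"
  have sp: "space ?M = Iv pi" by (simp add: space_restrict_space)
  have sq: "sets (sq_measure \<psi>) = sets (restrict_space borel (fin_dom \<psi>))"
    unfolding sq_measure_def by (simp add: sets_restrict_space)
  have open_I: "Iv pi \<in> sets borel" by (simp add: Iv_def)
  have sub: "B \<in> sets (restrict_space borel (fin_dom \<psi>))"
    if "B \<in> sets ?M" "B \<subseteq> fin_dom \<psi>" for B
  proof -
    have "B \<in> sets borel" using that(1) open_I by (auto simp: sets_restrict_space)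
    then show ?thesis using that(2) by (auto simp: sets_restrict_space intro!: image_eqI[of _ _ B])
  qed
  have ca: "countably_additive (sets ?M) ?f"
  proof (rule countably_additiveI)
    fix B :: "nat \<Rightarrow> real set"
    assume B: "range B \<subseteq> sets ?M" "disjoint_family B" "(\<Union>i. B i) \<in> sets ?M"
    show "(\<Sum>i. ?f (B i)) = ?f (\<Union>i. B i)"
    proof (cases "(\<Union>i. B i) \<subseteq> fin_dom \<psi>")
      case True
      then have Bi: "B i \<subseteq> fin_dom \<psi>" for i by blast
      have r: "range B \<subseteq> sets (restrict_space borel (fin_dom \<psi>))"
        using sub Bi B(1) by blast
      have "(\<Sum>i. ?f (B i)) = (\<Sum>i. emeasure \<mu> (B i) + emeasure (sq_measure \<psi>) (B i))"
        using Bi by simp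
      also have "\<dots> = (\<Sum>i. emeasure \<mu> (B i)) + (\<Sum>i. emeasure (sq_measure \<psi>) (B i))"
        by (simp add: suminf_add[symmetric])
      also have "\<dots> = emeasure \<mu> (\<Union>i. B i) + emeasure (sq_measure \<psi>) (\<Union>i. B i)"
        using r B(2) by (simp add: suminf_emeasure \<mu> sq)
      finally show ?thesis using True by simp
    next
      case False
      then obtain i where i: "\<not> B i \<subseteq> fin_dom \<psi>" by blast
      have "?f (B i) \<le> (\<Sum>i. ?f (B i))"
        using sum_le_suminf[of "\<lambda>i. ?f (B i)" "{i}"] by (auto simp: summableI)
      then show ?thesis using False i by (simp add: top_unique)
    qed
  qed
  have pos: "positive (sets ?M) ?f" by (simp add: positive_def)
  show ?thesis
    unfolding ext_potential_def
  proof (rule emeasure_measure_of_sigma)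
    show "sigma_algebra (Iv pi) (sets ?M)" using sets.sigma_algebra_axioms[of ?M] sp by simp
  qed (use ca pos A in auto)
qed

end

theory Submission imports Defs begin

text \<open>
  Let \<open>p\<close> be the real-valued restriction of \<open>\<psi>\<close> to \<open>I\<^sub>d\<close>. As the measure \<open>\<mu>\<close> in the potential is the
  distributional derivative of \<open>p\<close>, the energy of \<open>v\<close> is the integral of \<open>(v' - p v)\<^sup>2\<close>, and completing
  the square with an arbitrary function \<open>s\<close> shows that it is at least the integral of
  \<open>v\<^sup>2 (s' + 2 p s - s\<^sup>2)\<close>. Here \<open>p\<close> enters without its derivative. For the extremal \<open>p = tan\<close> the choice
  \<open>s = 3 tan\<close> makes the bracket equal to 3, and it would do for every odd \<open>p\<close>, since then
  \<open>p \<ge> tan\<close> on the right half.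

  A general \<open>p\<close> is only known through the differences \<open>p y - p x \<ge> 2 tan ((y - x) / 2)\<close>. Therefore \<open>s\<close> is
  adapted to \<open>v\<close>: two points are partners if the measure \<open>v\<^sup>2 dx\<close> has as much mass to the left of the
  one as to the right of the other, and \<open>s\<close> takes the values \<open>S t\<close> and \<open>- S t\<close> at the right and left
  partners, \<open>t\<close> being half of their distance. Summing over partners, \<open>p\<close> occurs only in the form
  \<open>p y - p x\<close>, and the term with \<open>s'\<close> can only gain, by \<open>\<theta> + 1 / \<theta> \<ge> 2\<close> for the ratio \<open>\<theta>\<close> of the densities
  (\<open>two_point_inequality\<close>). The outcome (\<open>lambda1_ge_of_modulus\<close>) is \<open>\<lambda>\<^sub>1 \<ge> \<Lambda>\<close> whenever
  \<open>p y - p x \<ge> G ((y - x) / 2)\<close> and some odd increasing \<open>S\<close> satisfies \<open>S' + S G - S\<^sup>2 \<ge> \<Lambda>\<close> on \<open>[0, d / 2)\<close>.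

  Both parts follow by perturbing \<open>S = 3 tan\<close>. In the first part, \<open>S\<close> only has to live on \<open>[0, d / 2)\<close>, and this
  leaves room of order \<open>(\<pi> - d)\<^sup>3\<close> (\<open>lambda1_ge_of_small_domain\<close>). In the second part, \<open>h\<close> is
  affine near the centre, which makes \<open>g\<close> increase there by an amount controlled by the ratio of
  \<open>h a\<close> and \<open>h b\<close> (\<open>log_derivative_gap\<close>); all pairs at distance more than \<open>\<pi> / 2\<close> see this
  increase, and a small correction of \<open>S\<close> distributes the surplus to the other pairs
  (\<open>lambda1_ge_of_jump\<close>).

  The remaining work is analytic. Elements of \<open>H\<^sup>1\<^sub>0\<close> are replaced by soft-thresholded test
  functions, whose potential energy does not exceed that of \<open>v\<close> (\<open>lambda1_geI\<close>), and the
  definition of \<open>\<mu>\<close> is extended from test functions to \<open>C\<^sup>1\<close> functions of them by polynomial approximation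
  (\<open>has_distr_deriv_comp\<close>).
\<close>

section \<open>Test functions and the distributional chain rule\<close>
text \<open>
  A derivative of order \<open>n\<close> of a product involves derivatives of both factors up to order \<open>n\<close>; a
  predicate of bounded order makes the induction for products a two-line unfolding.
\<close>
definition diff_upto :: "nat \<Rightarrow> (real \<Rightarrow> real) \<Rightarrow> bool" where
  "diff_upto n f \<longleftrightarrow> (\<forall>k\<le>n. \<forall>x. ((deriv ^^ k) f) differentiable (at x))"

lemma diff_upto_0: "diff_upto 0 f \<longleftrightarrow> (\<forall>x. f differentiable (at x))"
  by (simp add: diff_upto_def)

lemma diff_upto_Suc:
  "diff_upto (Suc n) f \<longleftrightarrow> (\<forall>x. f differentiable (at x)) \<and> diff_upto n (deriv f)"
proof -
  have "(\<forall>k\<le>Suc n. P k) \<longleftrightarrow> P 0 \<and> (\<forall>k\<le>n. P (Suc k))" for P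
    by (metis Suc_le_mono not0_implies_Suc zero_le)
  then show ?thesis
    unfolding diff_upto_def by (simp add: funpow_swap1 del: funpow.simps) (simp add: funpow_Suc_right del: funpow.simps)
qed

lemma diff_upto_mono: "diff_upto n f \<Longrightarrow> m \<le> n \<Longrightarrow> diff_upto m f"
  by (auto simp: diff_upto_def)

lemma diff_upto_differentiable: "diff_upto n f \<Longrightarrow> f differentiable (at x)"
  using diff_upto_mono[of n f 0] by (simp add: diff_upto_0)

lemma differentiable_DERIV: "f differentiable (at x) \<Longrightarrow> (f has_real_derivative deriv f x) (at x)"
  for f :: "real \<Rightarrow> real"
  using DERIV_deriv_iff_real_differentiable by blast

lemma diff_upto_add: "diff_upto n f \<Longrightarrow> diff_upto n g \<Longrightarrow> diff_upto n (\<lambda>x. f x + g x)"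
proof (induction n arbitrary: f g)
  case 0
  then show ?case by (auto simp: diff_upto_0)
next
  case (Suc n)
  then have d: "f differentiable (at x)" "g differentiable (at x)" for x
    by (auto simp: diff_upto_Suc)
  then have "deriv (\<lambda>x. f x + g x) = (\<lambda>x. deriv f x + deriv g x)"
    by (intro ext DERIV_imp_deriv DERIV_add differentiable_DERIV) auto
  then show ?case using Suc d by (auto simp: diff_upto_Suc)
qed

lemma diff_upto_mult: "diff_upto n f \<Longrightarrow> diff_upto n g \<Longrightarrow> diff_upto n (\<lambda>x. f x * g x)"
proof (induction n arbitrary: f g)
  case 0
  then show ?case by (auto simp: diff_upto_0)
next
  case (Suc n)
  then have d: "f differentiable (at x)" "g differentiable (at x)" for x
    by (auto simp: diff_upto_Suc)
  have "deriv (\<lambda>x. f x * g x) x = f x * deriv g x + deriv f x * g x" for x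
    using DERIV_mult[OF differentiable_DERIV[OF d(1)] differentiable_DERIV[OF d(2)], of x]
    by (intro DERIV_imp_deriv) (simp add: algebra_simps)
  then have "deriv (\<lambda>x. f x * g x) = (\<lambda>x. f x * deriv g x + deriv f x * g x)" by blast
  moreover have "diff_upto n f" "diff_upto n g" "diff_upto n (deriv f)" "diff_upto n (deriv g)"
    using Suc.prems diff_upto_mono[of "Suc n" f n] diff_upto_mono[of "Suc n" g n]
    unfolding diff_upto_Suc by auto
  ultimately show ?case using Suc d by (auto simp: diff_upto_Suc intro!: diff_upto_add)
qed

lemma diff_upto_const: "diff_upto n (\<lambda>x. c)"
  by (induction n arbitrary: c) (auto simp: diff_upto_0 diff_upto_Suc)

lemma diff_upto_power: "diff_upto n f \<Longrightarrow> diff_upto n (\<lambda>x. f x ^ k)"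
  by (induction k) (auto intro: diff_upto_const diff_upto_mult)

lemma diff_upto_sum:
  "(\<And>i. i \<in> A \<Longrightarrow> diff_upto n (f i)) \<Longrightarrow> diff_upto n (\<lambda>x. \<Sum>i\<in>A. f i x)"
  by (induction A rule: infinite_finite_induct) (auto intro: diff_upto_const diff_upto_add)

lemma test_fun_iff:
  "\<phi> \<in> test_fun U \<longleftrightarrow>
    (\<forall>n. diff_upto n \<phi>) \<and> (\<exists>K. compact K \<and> K \<subseteq> U \<and> (\<forall>x. x \<notin> K \<longrightarrow> \<phi> x = 0))"
  by (auto simp: test_fun_def diff_upto_def)

lemma test_fun_DERIV: "\<phi> \<in> test_fun U \<Longrightarrow> (\<phi> has_real_derivative deriv \<phi> x) (at x)"
  by (auto simp: test_fun_iff intro: differentiable_DERIV diff_upto_differentiable)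

lemma test_fun_continuous_deriv: "\<phi> \<in> test_fun U \<Longrightarrow> continuous_on A (deriv \<phi>)"
proof -
  assume "\<phi> \<in> test_fun U"
  then have "diff_upto 1 \<phi>" by (auto simp: test_fun_iff)
  then have "deriv \<phi> differentiable (at x)" for x by (auto simp: diff_upto_Suc diff_upto_0)
  then show ?thesis
    by (meson continuous_at_imp_continuous_on differentiable_imp_continuous_within)
qed

lemma test_fun_continuous: "\<phi> \<in> test_fun U \<Longrightarrow> continuous_on A \<phi>"
  by (meson DERIV_isCont continuous_at_imp_continuous_on test_fun_DERIV)

text \<open>
  The constant term has to vanish for the support to stay compact.
\<close>
lemma test_fun_polynomial:
  assumes "\<phi> \<in> test_fun U"
  shows "(\<lambda>x. \<Sum>i\<le>n. a i * \<phi> x ^ Suc i) \<in> test_fun U"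
proof -
  from assms obtain K where K: "compact K" "K \<subseteq> U" "\<forall>x. x \<notin> K \<longrightarrow> \<phi> x = 0"
    by (auto simp: test_fun_iff)
  have "diff_upto k (\<lambda>x. \<Sum>i\<le>n. a i * \<phi> x ^ Suc i)" for k
    using assms
    by (intro diff_upto_sum diff_upto_mult diff_upto_const diff_upto_power) (auto simp: test_fun_iff)
  then show ?thesis using K by (auto simp: test_fun_iff intro!: exI[of _ K])
qed

text \<open>
  For a polynomial \<open>g\<close> without constant term, \<open>g \<circ> \<phi>\<close> is again a test function and there is nothing
  to prove. A continuous \<open>g'\<close> is uniformly approximated by polynomials on the range of \<open>\<phi>\<close>
  (Weierstrass); integrating them gives \<open>P\<close> with \<open>\<bar>P z - g z\<bar> \<le> e * \<bar>z\<bar>\<close>, and the error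
  \<open>e * \<bar>\<phi>\<bar>\<close> is controlled because \<open>\<phi>\<close> itself is \<open>\<mu>\<close>-integrable. This is how functions that are
  only \<open>C\<^sup>1\<close> are tested against \<open>\<mu>\<close>.
\<close>
lemma has_distr_deriv_comp:
  assumes D: "has_distr_deriv U f \<mu>" and \<phi>: "\<phi> \<in> test_fun U"
    and g: "\<And>z. (g has_real_derivative g' z) (at z)" "continuous_on UNIV g'" "g 0 = 0"
  shows "integrable \<mu> (\<lambda>x. g (\<phi> x))"
    and "set_integrable lborel U (\<lambda>x. f x * (g' (\<phi> x) * deriv \<phi> x))"
    and "(LINT x|\<mu>. g (\<phi> x)) = - (LINT x:U|lborel. f x * (g' (\<phi> x) * deriv \<phi> x))"
proof -
  from \<phi> obtain K where K: "compact K" "K \<subseteq> U" "\<And>x. x \<notin> K \<Longrightarrow> \<phi> x = 0"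
    by (auto simp: test_fun_iff)
  have "compact (\<phi> ` K)" using K test_fun_continuous[OF \<phi>] by (intro compact_continuous_image)
  then obtain R0 where R0: "\<And>y. y \<in> \<phi> ` K \<Longrightarrow> \<bar>y\<bar> \<le> R0"
    using compact_imp_bounded[of "\<phi> ` K"] by (auto simp: bounded_iff)
  define R where "R = max R0 0"
  have R: "\<bar>\<phi> x\<bar> \<le> R" for x using R0[of "\<phi> x"] K(3)[of x] by (cases "x \<in> K") (auto simp: R_def)
  have R_0: "R \<ge> 0" by (simp add: R_def)
  have cg: "continuous_on UNIV g" using g(1) by (meson DERIV_isCont continuous_at_imp_continuous_on)
  obtain B where B: "\<And>z. \<bar>z\<bar> \<le> R \<Longrightarrow> \<bar>g' z\<bar> \<le> B"
  proof -
    have "compact (g' ` {-R..R})"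
      using g(2) by (intro compact_continuous_image) (auto intro: continuous_on_subset)
    then obtain B where "\<And>y. y \<in> g' ` {-R..R} \<Longrightarrow> \<bar>y\<bar> \<le> B"
      using compact_imp_bounded by (force simp: bounded_iff)
    note B = this
    show ?thesis
    proof (rule that)
      fix z assume "\<bar>z\<bar> \<le> R"
      then have "g' z \<in> g' ` {-R..R}" by (intro imageI) auto
      then show "\<bar>g' z\<bar> \<le> B" by (rule B)
    qed
  qed
  \<comment> \<open>Mean value theorem at the common zero 0 of all outer functions.\<close>
  have mv: "\<bar>G z\<bar> \<le> C * \<bar>z\<bar>"
    if "\<And>z. (G has_real_derivative G' z) (at z)" "\<And>z. \<bar>z\<bar> \<le> R \<Longrightarrow> \<bar>G' z\<bar> \<le> C" "G 0 = 0"
      "\<bar>z\<bar> \<le> R" for G G' :: "real \<Rightarrow> real" and C z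
  proof -
    have "norm (G z - G 0) \<le> C * norm (z - 0)"
      using that R_0 by (intro field_differentiable_bound[of "{-R..R}" G G'])
        (auto intro: DERIV_subset)
    then show ?thesis using that by simp
  qed
  have sets_mu: "sets \<mu> = sets (restrict_space borel U)" using D by (simp add: has_distr_deriv_def)
  have mU: "h \<in> borel_measurable \<mu>" if "continuous_on UNIV h" for h :: "real \<Rightarrow> real"
  proof -
    have "h \<in> borel_measurable borel" using that by (rule borel_measurable_continuous_onI)
    then have "h \<in> borel_measurable (restrict_space borel U)" by (rule measurable_restrict_space1)
    then show ?thesis using measurable_cong_sets[OF sets_mu refl] by blast
  qed
  have int\<phi>: "integrable \<mu> \<phi>" and intf: "set_integrable lborel U (\<lambda>x. f x * deriv \<phi> x)"
    using D \<phi> by (auto simp: has_distr_deriv_def)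
  show int: "integrable \<mu> (\<lambda>x. g (\<phi> x))"
  proof (rule Bochner_Integration.integrable_bound[of _ "\<lambda>x. B * \<phi> x"])
    show "integrable \<mu> (\<lambda>x. B * \<phi> x)" using int\<phi> by simp
    show "(\<lambda>x. g (\<phi> x)) \<in> borel_measurable \<mu>"
      by (intro mU continuous_on_compose2[OF cg] test_fun_continuous[OF \<phi>]) auto
    have "\<bar>g (\<phi> x)\<bar> \<le> B * \<bar>\<phi> x\<bar>" for x
      by (rule mv[OF g(1) B g(3) R])
    moreover have "B \<ge> 0" using B[of 0] R_0 by auto
    ultimately show "AE x in \<mu>. norm (g (\<phi> x)) \<le> norm (B * \<phi> x)" by (simp add: abs_mult)
  qed
  have bnd: "set_integrable lborel U (\<lambda>x. f x * (k (\<phi> x) * deriv \<phi> x))"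
     if "continuous_on UNIV k" "\<And>z. \<bar>z\<bar> \<le> R \<Longrightarrow> \<bar>k z\<bar> \<le> C" for k C
  proof -
    have "(\<lambda>x. k (\<phi> x)) \<in> borel_measurable lborel"
      using continuous_on_compose2[OF that(1) test_fun_continuous[OF \<phi>, of UNIV]]
      by (auto intro: borel_measurable_continuous_onI)
    moreover have "(\<lambda>x. indicator U x *\<^sub>R (f x * deriv \<phi> x)) \<in> borel_measurable lborel"
      using intf unfolding set_integrable_def by (rule borel_measurable_integrable)
    ultimately have m: "(\<lambda>x. k (\<phi> x) * (indicator U x *\<^sub>R (f x * deriv \<phi> x))) \<in> borel_measurable lborel"
      by (rule borel_measurable_times)
    have C: "C \<ge> 0" using that(2)[of 0] R_0 by auto
    have "integrable lborel (\<lambda>x. k (\<phi> x) * (indicator U x *\<^sub>R (f x * deriv \<phi> x)))"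
    proof (rule Bochner_Integration.integrable_bound[OF _ m])
      show "integrable lborel (\<lambda>x. C * (indicator U x *\<^sub>R (f x * deriv \<phi> x)))"
        using intf unfolding set_integrable_def by (rule integrable_mult_right)
      have "\<bar>k (\<phi> x)\<bar> \<le> \<bar>C\<bar>" for x using that(2)[OF R, of x] by simp
      then show "AE x in lborel. norm (k (\<phi> x) * (indicator U x *\<^sub>R (f x * deriv \<phi> x)))
          \<le> norm (C * (indicator U x *\<^sub>R (f x * deriv \<phi> x)))"
        unfolding real_norm_def real_scaleR_def abs_mult by (intro AE_I2 mult_right_mono) auto
    qed
    then show ?thesis unfolding set_integrable_def by (simp add: ac_simps)
  qed
  show int2: "set_integrable lborel U (\<lambda>x. f x * (g' (\<phi> x) * deriv \<phi> x))"
    using bnd[OF g(2) B] by simp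
  let ?A = "LINT x|\<mu>. g (\<phi> x)" and ?B = "LINT x:U|lborel. f x * (g' (\<phi> x) * deriv \<phi> x)"
  define C1 where "C1 = (LINT x|\<mu>. \<bar>\<phi> x\<bar>)"
  define C2 where "C2 = (LINT x:U|lborel. \<bar>f x * deriv \<phi> x\<bar>)"
  have "\<bar>?A + ?B\<bar> \<le> e * (C1 + C2)" if e: "e > 0" for e
  proof -
    obtain p where p: "real_polynomial_function p" and p': "\<And>z. z \<in> {-R..R} \<Longrightarrow> \<bar>g' z - p z\<bar> < e"
      using Stone_Weierstrass_real_polynomial_function[of "{-R..R}" g' e] e g(2)
      by (auto intro: continuous_on_subset)
    have p2: "\<bar>g' z - p z\<bar> \<le> e" if "\<bar>z\<bar> \<le> R" for z
      using that by (intro less_imp_le p') (simp add: abs_le_iff)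
    from real_polynomial_function_imp_sum[OF p] obtain a n where
      pa: "p = (\<lambda>x. \<Sum>i\<le>n. a i * x ^ i)" by blast
    define P where "P z = (\<Sum>i\<le>n. a i / real (Suc i) * z ^ Suc i)" for z
    have dP: "(P has_real_derivative p z) (at z)" for z
      unfolding P_def pa
      by (rule DERIV_sum) (auto intro!: derivative_eq_intros simp del: power_Suc of_nat_Suc)
    have P0: "P 0 = 0" by (simp add: P_def)
    have tP: "(\<lambda>x. P (\<phi> x)) \<in> test_fun U" unfolding P_def by (rule test_fun_polynomial[OF \<phi>])
    have "deriv (\<lambda>x. P (\<phi> x)) = (\<lambda>x. p (\<phi> x) * deriv \<phi> x)"
      by (intro ext DERIV_imp_deriv DERIV_chain2[OF dP test_fun_DERIV[OF \<phi>]])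
    then have eqP: "(LINT x|\<mu>. P (\<phi> x)) = - (LINT x:U|lborel. f x * (p (\<phi> x) * deriv \<phi> x))"
      and iP: "integrable \<mu> (\<lambda>x. P (\<phi> x))" 
      and iP2: "set_integrable lborel U (\<lambda>x. f x * (p (\<phi> x) * deriv \<phi> x))"
      using D tP by (auto simp: has_distr_deriv_def)
    have "\<bar>?A - (LINT x|\<mu>. P (\<phi> x))\<bar> \<le> e * C1"
    proof -
      have "\<bar>?A - (LINT x|\<mu>. P (\<phi> x))\<bar> = \<bar>LINT x|\<mu>. g (\<phi> x) - P (\<phi> x)\<bar>"
        using int iP by simp
      also have "\<dots> \<le> (LINT x|\<mu>. e * \<bar>\<phi> x\<bar>)"
      proof (rule integral_abs_bound_integral)
        show "integrable \<mu> (\<lambda>x. g (\<phi> x) - P (\<phi> x))" using int iP by simp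
        show "integrable \<mu> (\<lambda>x. e * \<bar>\<phi> x\<bar>)" using int\<phi> by simp
        fix x
        show "\<bar>g (\<phi> x) - P (\<phi> x)\<bar> \<le> e * \<bar>\<phi> x\<bar>"
        proof (rule mv[of "\<lambda>z. g z - P z" "\<lambda>z. g' z - p z", OF DERIV_diff[OF g(1) dP] _ _ R])
          show "\<bar>g' z - p z\<bar> \<le> e" if "\<bar>z\<bar> \<le> R" for z
            using that by (rule p2)
        qed (simp add: P0 g(3))
      qed
      finally show ?thesis by (simp add: C1_def)
    qed
    moreover have "\<bar>?B - (LINT x:U|lborel. f x * (p (\<phi> x) * deriv \<phi> x))\<bar> \<le> e * C2"
    proof -
      have "?B - (LINT x:U|lborel. f x * (p (\<phi> x) * deriv \<phi> x)) =
        (LINT x:U|lborel. f x * (g' (\<phi> x) * deriv \<phi> x) - f x * (p (\<phi> x) * deriv \<phi> x))"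
        using int2 iP2 by (simp add: set_integral_diff)
      also have "\<bar>\<dots>\<bar> \<le> (LINT x|lborel. indicator U x *\<^sub>R (e * \<bar>f x * deriv \<phi> x\<bar>))"
        unfolding set_lebesgue_integral_def
      proof (rule integral_abs_bound_integral)
        show "integrable lborel (\<lambda>x. indicator U x *\<^sub>R
           (f x * (g' (\<phi> x) * deriv \<phi> x) - f x * (p (\<phi> x) * deriv \<phi> x)))"
          using set_integral_diff(1)[OF int2 iP2] unfolding set_integrable_def .
        show "integrable lborel (\<lambda>x. indicator U x *\<^sub>R (e * \<bar>f x * deriv \<phi> x\<bar>))"
          using set_integrable_mult_right[of e lborel U, OF set_integrable_abs[OF intf]]
          unfolding set_integrable_def by simp
        fix x
        have "\<bar>f x * (g' (\<phi> x) * deriv \<phi> x) - f x * (p (\<phi> x) * deriv \<phi> x)\<bar>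
          = \<bar>g' (\<phi> x) - p (\<phi> x)\<bar> * \<bar>f x * deriv \<phi> x\<bar>"
          by (simp add: abs_mult[symmetric] algebra_simps)
        also have "\<dots> \<le> e * \<bar>f x * deriv \<phi> x\<bar>"
          using p2[OF R[of x]] by (intro mult_right_mono) auto
        finally show "\<bar>indicator U x *\<^sub>R (f x * (g' (\<phi> x) * deriv \<phi> x) - f x * (p (\<phi> x) * deriv \<phi> x))\<bar>
            \<le> indicator U x *\<^sub>R (e * \<bar>f x * deriv \<phi> x\<bar>)"
          by (simp add: indicator_def)
      qed
      also have "\<dots> = e * C2"
        unfolding C2_def set_lebesgue_integral_def
        by (subst integral_mult_right_zero[symmetric]) (simp add: ac_simps)
      finally show ?thesis .
    qed
    ultimately show ?thesis using eqP by (simp add: algebra_simps)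
  qed
  note bound = this
  have "?A + ?B = 0"
  proof (rule ccontr)
    assume n: "?A + ?B \<noteq> 0"
    have "C1 + C2 \<noteq> 0" using bound[of 1] n by auto
    moreover have "C1 + C2 \<ge> 0" using bound[of 1] by simp
    ultimately have C: "C1 + C2 > 0" by simp
    have "\<bar>?A + ?B\<bar> \<le> \<bar>?A + ?B\<bar> / (2 * (C1 + C2)) * (C1 + C2)"
      using n C by (intro bound divide_pos_pos) auto
    also have "\<dots> = \<bar>?A + ?B\<bar> / 2"
    proof -
      have "t / (2 * c) * c = t / 2" if "c > 0" for t c :: real using that by simp
      from this[OF C] show ?thesis .
    qed
    finally show False using n by simp
  qed
  then show "?A = - ?B" by simp
qed

section \<open>Integration against the potential\<close>

lemma sets_restrict_ext_potential:
  assumes "d \<le> pi"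
  shows "sets (restrict_space (ext_potential \<psi> \<mu>) (Iv d)) = sets (restrict_space borel (Iv d))"
proof -
  have "Iv d \<inter> (Iv pi \<inter> A) = Iv d \<inter> A" for A using assms by (auto simp: Iv_def)
  then show ?thesis by (simp add: sets_restrict_space sets_ext_potential image_image)
qed

text \<open>
  On the finiteness domain the potential is the sum of two measures; the identity for sets extends
  to functions by the monotone class argument.
\<close>
lemma nn_integral_ext_potential:
  assumes \<mu>: "sets \<mu> = sets (restrict_space borel (Iv d))" and dom: "fin_dom \<psi> = Iv d"
    and d: "d \<le> pi" and f: "f \<in> borel_measurable (restrict_space borel (Iv d))"
  shows "(\<integral>\<^sup>+x. f x \<partial>(restrict_space (ext_potential \<psi> \<mu>) (Iv d)))
       = (\<integral>\<^sup>+x. f x \<partial>\<mu>) + (\<integral>\<^sup>+x. f x \<partial>(sq_measure \<psi>))"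
proof -
  let ?B = "restrict_space borel (Iv d)" and ?q = "restrict_space (ext_potential \<psi> \<mu>) (Iv d)"
  have sub: "Iv d \<subseteq> Iv pi" using d by (auto simp: Iv_def)
  have Ib: "Iv l \<in> sets borel" for l by (simp add: Iv_def)
  have Iq: "Iv d \<in> sets (ext_potential \<psi> \<mu>)"
    using sub Ib unfolding sets_ext_potential by (auto simp: sets_restrict_space intro!: image_eqI[of _ _ "Iv d"])
  have sq: "sets (sq_measure \<psi>) = sets ?B"
    unfolding sq_measure_def dom by (simp add: sets_restrict_space)
  have sp: "space \<mu> = Iv d" "space (sq_measure \<psi>) = Iv d" "space ?B = Iv d"
    using sets_eq_imp_space_eq[OF \<mu>] sets_eq_imp_space_eq[OF sq] by (auto simp: space_restrict_space)
  have sets_q: "sets ?q = sets ?B"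
    using d by (rule sets_restrict_ext_potential)
  have spq: "space ?q = Iv d" using sets_eq_imp_space_eq[OF sets_q] sp by simp
  have meas: "g \<in> borel_measurable \<mu>" "g \<in> borel_measurable ?q" "g \<in> borel_measurable (sq_measure \<psi>)"
    if "g \<in> borel_measurable ?B" for g :: "real \<Rightarrow> ennreal"
    using that measurable_cong_sets[OF \<mu> refl] measurable_cong_sets[OF sq refl]
      measurable_cong_sets[OF sets_q refl] by blast+
  from f show ?thesis
  proof (induction rule: borel_measurable_induct)
    case (cong f g)
    have "(\<integral>\<^sup>+x. f x \<partial>M) = (\<integral>\<^sup>+x. g x \<partial>M)" if "space M = Iv d" for M
      using cong(3) that sp by (intro nn_integral_cong) auto
    then show ?case using cong sp spq by auto
  next
    case (set A)
    have A: "A \<in> sets \<mu>" "A \<in> sets ?q" "A \<in> sets (sq_measure \<psi>)"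
      using set \<mu> sq sets_q by auto
    have AI: "A \<subseteq> Iv d" using sets.sets_into_space[OF A(1)] sp by simp
    have "A \<in> sets borel" using set Ib by (auto simp: sets_restrict_space)
    then have A2: "A \<in> sets (restrict_space borel (Iv pi))"
      using AI sub by (auto simp: sets_restrict_space intro!: image_eqI[of _ _ A])
    have "emeasure ?q A = emeasure (ext_potential \<psi> \<mu>) A"
      using Iq AI by (intro emeasure_restrict_space) (auto simp: sets.Int_space_eq2)
    also have "\<dots> = emeasure \<mu> A + emeasure (sq_measure \<psi>) A"
      using AI A2 \<mu> by (subst emeasure_ext_potential) (auto simp: dom)
    finally show ?case using A by simp
  next
    case (mult u c)
    have "(\<integral>\<^sup>+x. c * u x \<partial>M) = c * (\<integral>\<^sup>+x. u x \<partial>M)" if "u \<in> borel_measurable M" for M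
      using that by (rule nn_integral_cmult)
    then show ?case using meas[OF mult.hyps(2)] mult.IH by (metis distrib_left)
  next
    case (add u v)
    have "(\<integral>\<^sup>+x. v x + u x \<partial>M) = (\<integral>\<^sup>+x. v x \<partial>M) + (\<integral>\<^sup>+x. u x \<partial>M)"
      if "u \<in> borel_measurable M" "v \<in> borel_measurable M" for M
      using that by (intro nn_integral_add)
    note e = this[OF meas(1)[OF add.hyps(1)] meas(1)[OF add.hyps(3)]] this[OF meas(2)[OF add.hyps(1)] meas(2)[OF add.hyps(3)]]
      this[OF meas(3)[OF add.hyps(1)] meas(3)[OF add.hyps(3)]]
    show ?case unfolding e add.IH by (simp only: ac_simps)
  next
    case (seq U)
    have m: "U i \<in> borel_measurable \<mu>" "U i \<in> borel_measurable ?q" "U i \<in> borel_measurable (sq_measure \<psi>)" for i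
      using meas[OF seq.hyps(1)] by auto
    have inc: "incseq (\<lambda>i. nn_integral M (U i))" for M
      using seq.hyps(3) by (auto simp: incseq_def le_fun_def intro: nn_integral_mono)
    have e: "(\<integral>\<^sup>+x. (SUP i. U i) x \<partial>M) = (SUP i. nn_integral M (U i))"
      if "\<And>i. U i \<in> borel_measurable M" for M
      unfolding SUP_apply using seq.hyps(3) that by (intro nn_integral_monotone_convergence_SUP) auto
    show ?case
      unfolding e[OF m(1)] e[OF m(2)] e[OF m(3)] seq.IH by (rule ennreal_SUP_add[OF inc inc])
  qed
qed

text \<open>
  The only way in which the potential term of the Rayleigh quotient of \<open>v\<close> is used: it bounds the
  two separate integrals of any smaller density \<open>U \<le> v\<^sup>2\<close>.
\<close>
lemma potential_integral_ge:
  fixes \<psi> :: "real \<Rightarrow> ereal" and v U :: "real \<Rightarrow> real"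
  defines "p \<equiv> \<lambda>x. real_of_ereal (\<psi> x)"
  assumes \<mu>: "sets \<mu> = sets (restrict_space borel (Iv d))" and dom: "fin_dom \<psi> = Iv d"
    and d: "d \<le> pi" and p: "p \<in> borel_measurable (restrict_space borel (Iv d))"
    and v: "set_integrable (ext_potential \<psi> \<mu>) (Iv d) (\<lambda>x. (v x)\<^sup>2)"
    and U: "\<And>x. x \<in> Iv d \<Longrightarrow> 0 \<le> U x \<and> U x \<le> (v x)\<^sup>2" "integrable \<mu> U"
      "set_integrable lborel (Iv d) (\<lambda>x. (p x)\<^sup>2 * U x)"
  shows "(LINT x|\<mu>. U x) + (LINT x:Iv d|lborel. (p x)\<^sup>2 * U x)
          \<le> (LINT x:Iv d|ext_potential \<psi> \<mu>. (v x)\<^sup>2)"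
proof -
  let ?B = "restrict_space borel (Iv d)" and ?q = "restrict_space (ext_potential \<psi> \<mu>) (Iv d)"
  let ?Q = "ext_potential \<psi> \<mu>"
  have sub: "Iv d \<subseteq> Iv pi" using d by (auto simp: Iv_def)
  have Ib: "Iv l \<in> sets borel" for l by (simp add: Iv_def)
  have Iq: "Iv d \<in> sets (ext_potential \<psi> \<mu>)"
    using sub Ib unfolding sets_ext_potential by (auto simp: sets_restrict_space intro!: image_eqI[of _ _ "Iv d"])
  then have Iq': "Iv d \<inter> space ?Q \<in> sets ?Q" by auto
  have sp: "space \<mu> = Iv d" using sets_eq_imp_space_eq[OF \<mu>] by (auto simp: space_restrict_space)
  have sets_q: "sets ?q = sets ?B"
    using d by (rule sets_restrict_ext_potential)
  have Um: "U \<in> borel_measurable ?B"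
    using borel_measurable_integrable[OF U(2)] measurable_cong_sets[OF \<mu> refl] by blast
  have v': "integrable ?q (\<lambda>x. (v x)\<^sup>2)"
    using v Iq' by (simp add: integrable_restrict_space set_integrable_def)
  have "ennreal (LINT x|\<mu>. U x) = (\<integral>\<^sup>+x. ennreal (U x) \<partial>\<mu>)"
    using U sp by (intro nn_integral_eq_integral[symmetric] AE_I2) auto
  moreover have "ennreal (LINT x:Iv d|lborel. (p x)\<^sup>2 * U x) = (\<integral>\<^sup>+x. ennreal (U x) \<partial>(sq_measure \<psi>))"
  proof -
    have "ennreal (LINT x:Iv d|lborel. (p x)\<^sup>2 * U x)
       = (\<integral>\<^sup>+x. ennreal (indicator (Iv d) x *\<^sub>R ((p x)\<^sup>2 * U x)) \<partial>lborel)"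
      unfolding set_lebesgue_integral_def using U
      by (intro nn_integral_eq_integral[symmetric] AE_I2) (auto simp: set_integrable_def indicator_def)
    also have "\<dots> = (\<integral>\<^sup>+x. ennreal ((p x)\<^sup>2 * U x) * indicator (Iv d) x \<partial>lborel)"
      by (intro nn_integral_cong) (auto simp: indicator_def)
    also have "\<dots> = (\<integral>\<^sup>+x. ennreal ((p x)\<^sup>2 * U x) \<partial>restrict_space lborel (Iv d))"
      using Ib by (subst nn_integral_restrict_space) auto
    also have "\<dots> = (\<integral>\<^sup>+x. ennreal ((p x)\<^sup>2) * ennreal (U x) \<partial>restrict_space lborel (Iv d))"
      using U by (intro nn_integral_cong) (auto simp: space_restrict_space ennreal_mult)
    also have "\<dots> = (\<integral>\<^sup>+x. ennreal (U x) \<partial>(sq_measure \<psi>))"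
    proof -
      have sl: "sets (restrict_space lborel (Iv d)) = sets ?B" by (simp add: sets_restrict_space)
      have "(\<lambda>x. ennreal ((p x)\<^sup>2)) \<in> borel_measurable ?B" "(\<lambda>x. ennreal (U x)) \<in> borel_measurable ?B"
        using p Um by measurable
      then have "(\<lambda>x. ennreal ((p x)\<^sup>2)) \<in> borel_measurable (restrict_space lborel (Iv d))"
        "(\<lambda>x. ennreal (U x)) \<in> borel_measurable (restrict_space lborel (Iv d))"
        using measurable_cong_sets[OF sl refl] by blast+
      then show ?thesis
        unfolding sq_measure_def dom p_def by (rule nn_integral_density[symmetric])
    qed
    finally show ?thesis .
  qed
  ultimately have "ennreal (LINT x|\<mu>. U x) + ennreal (LINT x:Iv d|lborel. (p x)\<^sup>2 * U x)
    = (\<integral>\<^sup>+x. ennreal (U x) \<partial>?q)"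
    using nn_integral_ext_potential[OF \<mu> dom d, of "\<lambda>x. ennreal (U x)"] Um by simp
  also have "\<dots> \<le> (\<integral>\<^sup>+x. ennreal ((v x)\<^sup>2) \<partial>?q)"
    using U(1) by (intro nn_integral_mono ennreal_leI) (auto simp: space_restrict_space)
  also have "\<dots> = ennreal (LINT x|?q. (v x)\<^sup>2)"
    using v' by (intro nn_integral_eq_integral) auto
  also have "(LINT x|?q. (v x)\<^sup>2) = (LINT x:Iv d|?Q. (v x)\<^sup>2)"
    using Iq' by (simp add: integral_restrict_space set_lebesgue_integral_def)
  finally have le: "ennreal (LINT x|\<mu>. U x) + ennreal (LINT x:Iv d|lborel. (p x)\<^sup>2 * U x)
     \<le> ennreal (LINT x:Iv d|?Q. (v x)\<^sup>2)" .
  have "0 \<le> (LINT x|\<mu>. U x)" using U sp by (intro Bochner_Integration.integral_nonneg_AE AE_I2) auto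
  moreover have "0 \<le> (LINT x:Iv d|lborel. (p x)\<^sup>2 * U x)" unfolding set_lebesgue_integral_def
    using U by (intro Bochner_Integration.integral_nonneg_AE AE_I2) (auto simp: indicator_def)
  moreover have "0 \<le> (LINT x:Iv d|?Q. (v x)\<^sup>2)" unfolding set_lebesgue_integral_def
    by (intro Bochner_Integration.integral_nonneg_AE AE_I2) (auto simp: indicator_def)
  ultimately show ?thesis using le by (simp add: ennreal_plus[symmetric] del: ennreal_plus)
qed

section \<open>Reduction to soft-thresholded test functions\<close>

text \<open>
  Soft thresholding moves \<open>z\<close> towards 0 by \<open>\<delta>\<close>. If \<open>\<phi>\<close> is uniformly \<open>\<delta>\<close>-close to \<open>v\<close>, then
  \<open>soft \<delta> \<circ> \<phi>\<close> is dominated by \<open>\<bar>v\<bar>\<close> pointwise, so that its integral against an arbitrary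
  potential cannot exceed that of \<open>v\<close>, however singular the potential is at the boundary.
\<close>
definition soft :: "real \<Rightarrow> real \<Rightarrow> real" where
  "soft \<delta> z = z - max (- \<delta>) (min \<delta> z)"

lemma soft_0 [simp]: "\<delta> \<ge> 0 \<Longrightarrow> soft \<delta> 0 = 0"
  by (simp add: soft_def)

lemma continuous_on_soft [continuous_intros]:
  "continuous_on A f \<Longrightarrow> continuous_on A (\<lambda>x. soft \<delta> (f x))"
  unfolding soft_def by (intro continuous_intros)

lemma soft_close: "\<delta> \<ge> 0 \<Longrightarrow> \<bar>soft \<delta> z - z\<bar> \<le> \<delta>"
  by (auto simp: soft_def)

lemma soft_le: "\<delta> \<ge> 0 \<Longrightarrow> \<bar>z - v\<bar> \<le> \<delta> \<Longrightarrow> \<bar>soft \<delta> z\<bar> \<le> \<bar>v\<bar>"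
  by (auto simp: soft_def max_def min_def abs_if split: if_splits)

text \<open>
  The square of \<open>soft \<delta> z\<close> is the sum of the squares of the positive parts of \<open>z - \<delta>\<close> and
  \<open>- z - \<delta>\<close>, and squaring smooths the kink of a positive part.
\<close>
lemma DERIV_soft_sq:
  assumes "\<delta> \<ge> 0"
  shows "((\<lambda>z. (soft \<delta> z)\<^sup>2) has_real_derivative 2 * soft \<delta> z) (at z)"
proof -
  have *: "((\<lambda>z. (max (z - \<delta>) 0)\<^sup>2) has_real_derivative 2 * max (z - \<delta>) 0) (at z)" for z \<delta> :: real
  proof (cases "z = \<delta>")
    case True
    have "((\<lambda>h. (max (z + h - \<delta>) 0)\<^sup>2 / h) \<longlongrightarrow> 0) (at 0)"
    proof (rule Lim_null_comparison)
      show "eventually (\<lambda>h. norm ((max (z + h - \<delta>) 0)\<^sup>2 / h) \<le> \<bar>h\<bar>) (at 0)"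
        using True by (intro always_eventually) (auto simp: max_def power2_eq_square)
      show "((\<lambda>h::real. \<bar>h\<bar>) \<longlongrightarrow> 0) (at 0)" by (rule tendsto_eq_intros refl | simp)+
    qed
    then show ?thesis using True by (simp add: DERIV_def)
  next
    case False
    show ?thesis
    proof (cases "z > \<delta>")
      case True
      have "((\<lambda>z. (z - \<delta>)\<^sup>2) has_real_derivative 2 * max (z - \<delta>) 0) (at z)"
        using True by (auto intro!: derivative_eq_intros)
      moreover have "eventually (\<lambda>y. y \<in> {\<delta><..}) (nhds z)"
        using True by (intro eventually_nhds_in_open) auto
      then have "eventually (\<lambda>y. (y - \<delta>)\<^sup>2 = (max (y - \<delta>) 0)\<^sup>2) (nhds z)"
        by eventually_elim auto
      ultimately show ?thesis by (subst (asm) DERIV_cong_ev[OF refl _ refl]) auto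
    next
      case F: False
      have "((\<lambda>z. 0) has_real_derivative 2 * max (z - \<delta>) 0) (at z)"
        using F by (auto intro!: derivative_eq_intros)
      moreover have "eventually (\<lambda>y. y \<in> {..<\<delta>}) (nhds z)"
        using F False by (intro eventually_nhds_in_open) auto
      then have "eventually (\<lambda>y. 0 = (max (y - \<delta>) 0)\<^sup>2) (nhds z)"
        by eventually_elim auto
      ultimately show ?thesis by (subst (asm) DERIV_cong_ev[OF refl _ refl]) auto
    qed
  qed
  have eq: "(soft \<delta> z)\<^sup>2 = (max (z - \<delta>) 0)\<^sup>2 + (max (- z - \<delta>) 0)\<^sup>2" for z
    using assms by (auto simp: soft_def max_def min_def power2_eq_square algebra_simps)
  have "((\<lambda>z. (max (- z - \<delta>) 0)\<^sup>2) has_real_derivative 2 * max (- z - \<delta>) 0 * (-1)) (at z)"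
    by (rule DERIV_chain2[OF *]) (auto intro!: derivative_eq_intros)
  then have "((\<lambda>z. (soft \<delta> z)\<^sup>2) has_real_derivative 2 * max (z - \<delta>) 0 + 2 * max (- z - \<delta>) 0 * (-1)) (at z)"
    unfolding eq by (intro DERIV_add *)
  moreover have "2 * max (z - \<delta>) 0 + 2 * max (- z - \<delta>) 0 * (-1) = 2 * soft \<delta> z"
    using assms by (auto simp: soft_def max_def min_def)
  ultimately show ?thesis by simp
qed

lemma test_fun_support:
  assumes "\<phi> \<in> test_fun (Iv d)" "0 < d"
  obtains c where "0 < c" "c < d / 2" "\<And>x. c \<le> \<bar>x\<bar> \<Longrightarrow> \<phi> x = 0"
proof -
  from assms(1) obtain K where K: "compact K" "K \<subseteq> Iv d" "\<And>x. x \<notin> K \<Longrightarrow> \<phi> x = 0"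
    by (auto simp: test_fun_iff)
  have "compact (insert 0 (abs ` K))"
    using K(1) by (intro compact_insert compact_continuous_image continuous_intros)
  then obtain m where m: "m \<in> insert 0 (abs ` K)" "\<And>y. y \<in> insert 0 (abs ` K) \<Longrightarrow> y \<le> m"
    using compact_attains_sup[of "insert 0 (abs ` K)"] by (metis insert_not_empty)
  have md0: "0 \<le> m" using m(2)[of 0] by simp
  have md: "m < d / 2"
  proof (cases "m = 0")
    case False
    then obtain s where s: "s \<in> K" "m = \<bar>s\<bar>" using m(1) by blast
    then have "s \<in> Iv d" using K(2) by blast
    then show ?thesis using s(2) by (simp add: Iv_def abs_if)
  qed (use assms in simp)
  show ?thesis
  proof (rule that[of "(m + d / 2) / 2"])
    fix x assume "(m + d / 2) / 2 \<le> \<bar>x\<bar>"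
    then have "\<bar>x\<bar> > m" using md by simp
    then have "x \<notin> K" using m(2)[of "\<bar>x\<bar>"] by fastforce
    then show "\<phi> x = 0" by (rule K(3))
  qed (use md0 md assms(2) in simp_all)
qed

lemma Iv_borel [simp, measurable]: "Iv d \<in> sets borel"
  by (simp add: Iv_def)

lemma set_integrable_bounded_Iv:
  fixes f :: "real \<Rightarrow> real"
  assumes "set_borel_measurable lborel (Iv d) f" "\<And>x. x \<in> Iv d \<Longrightarrow> \<bar>f x\<bar> \<le> B"
  shows "set_integrable lborel (Iv d) f"
proof -
  have "emeasure lborel (Iv d) < \<infinity>" by (intro emeasure_bounded_finite) (simp add: Iv_def)
  then have "set_integrable lborel (Iv d) (\<lambda>x. B)"
    unfolding set_integrable_def real_scaleR_def
    by (intro integrable_mult_left integrable_real_indicator) auto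
  moreover have "AE x in lborel. norm (indicator (Iv d) x *\<^sub>R f x) \<le> norm (indicator (Iv d) x *\<^sub>R B)"
    using assms(2) by (intro AE_I2) (force simp: indicator_def)
  ultimately show ?thesis
    using assms(1) unfolding set_integrable_def set_borel_measurable_def
    by - (rule Bochner_Integration.integrable_bound)
qed

lemma set_borel_measurable_Iv_iff:
  "set_borel_measurable lborel (Iv d) f \<longleftrightarrow> f \<in> borel_measurable (restrict_space borel (Iv d))"
  for f :: "real \<Rightarrow> real"
  unfolding set_borel_measurable_def
  by (subst borel_measurable_restrict_space_iff) auto

lemma set_integrable_continuous_Iv:
  fixes f :: "real \<Rightarrow> real"
  assumes "continuous_on UNIV f"
  shows "set_integrable lborel (Iv d) f"
proof (rule set_integrable_subset)
  show "set_integrable lborel {- d / 2..d / 2} f"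
    using assms by (intro borel_integrable_atLeastAtMost') (auto intro: continuous_on_subset)
qed (auto simp: Iv_def)

lemma set_integrable_const_Iv: "set_integrable lborel (Iv d) (\<lambda>x. c)" for c :: real
  by (intro set_integrable_continuous_Iv continuous_intros)

lemma L2_on_diff:
  assumes "L2_on (Iv d) f" "L2_on (Iv d) g"
  shows "L2_on (Iv d) (\<lambda>x. f x - g x)"
proof -
  have m: "set_borel_measurable lborel (Iv d) (\<lambda>x. f x - g x)"
    using assms by (auto simp: L2_on_def set_borel_measurable_Iv_iff)
  have i: "set_integrable lborel (Iv d) (\<lambda>x. 2 * (f x)\<^sup>2 + 2 * (g x)\<^sup>2)"
    using assms by (intro set_integral_add(1) set_integrable_mult_right) (auto simp: L2_on_def)
  have "set_integrable lborel (Iv d) (\<lambda>x. (f x - g x)\<^sup>2)"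
  proof (rule set_integrable_bound[OF i])
    show "set_borel_measurable lborel (Iv d) (\<lambda>x. (f x - g x)\<^sup>2)"
      using m unfolding set_borel_measurable_Iv_iff by measurable
    have "(f x - g x)\<^sup>2 \<le> 2 * (f x)\<^sup>2 + 2 * (g x)\<^sup>2" for x
      using sum_squares_bound[of "f x" "- g x"] by (simp add: power2_diff)
    then show "AE x in lborel. x \<in> Iv d \<longrightarrow> norm ((f x - g x)\<^sup>2) \<le> norm (2 * (f x)\<^sup>2 + 2 * (g x)\<^sup>2)"
      by simp
  qed
  then show ?thesis using m by (simp add: L2_on_def)
qed

lemma L2_on_integrable:
  assumes "L2_on (Iv d) f"
  shows "set_integrable lborel (Iv d) f"
proof (rule set_integrable_bound)
  show "set_integrable lborel (Iv d) (\<lambda>x. 1 + (f x)\<^sup>2)"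
    using assms by (intro set_integral_add(1) set_integrable_const_Iv) (simp add: L2_on_def)
  have "\<bar>y\<bar> \<le> 1 + y\<^sup>2" for y :: real
    using zero_le_power2[of "\<bar>y\<bar> - 1"] zero_le_power2[of "\<bar>y\<bar>"] unfolding power2_diff power2_abs by simp
  then show "AE x in lborel. x \<in> Iv d \<longrightarrow> norm (f x) \<le> norm (1 + (f x)\<^sup>2)"
    by (simp add: add_nonneg_nonneg)
qed (use assms in \<open>auto simp: L2_on_def\<close>)

lemma L2_on_continuous: "continuous_on UNIV f \<Longrightarrow> L2_on (Iv d) f"
  unfolding L2_on_def set_borel_measurable_Iv_iff
  by (auto intro!: set_integrable_continuous_Iv continuous_intros measurable_restrict_space1
      borel_measurable_continuous_onI)

lemma set_integral_nonneg_Iv: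
  "(\<And>x. x \<in> Iv d \<Longrightarrow> 0 \<le> f x) \<Longrightarrow> 0 \<le> (LINT x:Iv d|M. f x)" for f :: "real \<Rightarrow> real"
  unfolding set_lebesgue_integral_def
  by (intro Bochner_Integration.integral_nonneg_AE AE_I2) (auto simp: indicator_def)

text \<open>
  Upgrades equalities almost everywhere to equalities everywhere for continuous representatives;
  needed because the potential may charge Lebesgue null sets.
\<close>
lemma continuous_zero_of_sq_integral_zero:
  fixes h :: "real \<Rightarrow> real"
  assumes c: "continuous_on (Iv d) h" and i: "set_integrable lborel (Iv d) (\<lambda>x. (h x)\<^sup>2)"
    and z: "(LINT x:Iv d|lborel. (h x)\<^sup>2) = 0" and x: "x \<in> Iv d"
  shows "h x = 0"
proof (rule ccontr)
  assume "h x \<noteq> 0"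
  have "AE x in lborel. indicator (Iv d) x *\<^sub>R (h x)\<^sup>2 = 0"
    using i z unfolding set_integrable_def set_lebesgue_integral_def
    by (subst (asm) integral_nonneg_eq_0_iff_AE) (auto simp: indicator_def)
  then have "AE x in lebesgue. indicator (Iv d) x *\<^sub>R (h x)\<^sup>2 = 0" by (rule AE_completion)
  then have ae: "AE x in lebesgue. x \<notin> Iv d \<inter> h -` (- {0})"
    by eventually_elim (auto simp: indicator_def)
  have op: "open (Iv d \<inter> h -` (- {0}))"
    using c by (intro continuous_open_preimage) (auto simp: Iv_def)
  then have "Iv d \<inter> h -` (- {0}) \<in> sets lebesgue" by auto
  then have "negligible (Iv d \<inter> h -` (- {0}))"
    using ae by (simp add: negligible_iff_null_sets AE_iff_null_sets)
  then show False using op open_not_negligible[OF op] x \<open>h x \<noteq> 0\<close> by auto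
qed

lemma young_sq: "\<eta> > 0 \<Longrightarrow> x\<^sup>2 \<le> (1 + \<eta>) * y\<^sup>2 + (1 + 1 / \<eta>) * (x - y)\<^sup>2" for x y \<eta> :: real
proof -
  assume e: "\<eta> > 0"
  have "(1 + \<eta>) * y\<^sup>2 + (1 + 1 / \<eta>) * (x - y)\<^sup>2 - x\<^sup>2 = (\<eta> * y - (x - y))\<^sup>2 / \<eta>"
    using e by (simp add: field_simps power2_eq_square)
  also have "\<dots> \<ge> 0" using e by simp
  finally show ?thesis by simp
qed

text \<open>
  In dimension one, \<open>H\<^sup>1\<close>-convergence is uniform convergence: test functions vanish at the left end
  point, so they are the primitives of their derivatives, and these converge in \<open>L\<^sup>1\<close>. The
  uniform limit \<open>W\<close> is the primitive of \<open>w\<close>; it agrees with \<open>v\<close> by continuity.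
\<close>
lemma H10_uniform_approx:
  assumes H: "H10 (Iv d) v w" and d: "0 < d" and \<eta>: "\<eta> > 0"
  shows "\<exists>\<phi>\<in>test_fun (Iv d). (\<forall>x\<in>Iv d. \<bar>\<phi> x - v x\<bar> \<le> \<eta>) \<and>
    (LINT x:Iv d|lborel. (deriv \<phi> x - w x)\<^sup>2) \<le> \<eta>"
proof -
  let ?I = "Iv d"
  from H have cv: "continuous_on ?I v" and Lv: "L2_on ?I v" and Lw: "L2_on ?I w"
    by (auto simp: H10_def)
  from H obtain \<phi> where \<phi>: "\<And>n. \<phi> n \<in> test_fun ?I"
    and lim: "(\<lambda>n. LINT x:?I|lborel. (\<phi> n x - v x)\<^sup>2 + (deriv (\<phi> n) x - w x)\<^sup>2) \<longlonglongrightarrow> 0"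
    by (auto simp: H10_def)
  have i1: "set_integrable lborel ?I (\<lambda>x. (\<phi> n x - v x)\<^sup>2)" for n
    using L2_on_diff[OF L2_on_continuous[OF test_fun_continuous[OF \<phi>]] Lv] by (simp add: L2_on_def)
  have L2: "L2_on ?I (\<lambda>x. deriv (\<phi> n) x - w x)" for n
    using L2_on_diff[OF L2_on_continuous[OF test_fun_continuous_deriv[OF \<phi>]] Lw] .
  then have i2: "set_integrable lborel ?I (\<lambda>x. (deriv (\<phi> n) x - w x)\<^sup>2)" for n
    by (simp add: L2_on_def)
  define e1 where "e1 n = (LINT x:?I|lborel. (\<phi> n x - v x)\<^sup>2)" for n
  define e2 where "e2 n = (LINT x:?I|lborel. (deriv (\<phi> n) x - w x)\<^sup>2)" for n
  have e0: "e1 n \<ge> 0" "e2 n \<ge> 0" for n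
    unfolding e1_def e2_def by (auto intro!: set_integral_nonneg_Iv)
  have sum: "(\<lambda>n. e1 n + e2 n) \<longlonglongrightarrow> 0"
    using lim unfolding e1_def e2_def by (simp add: set_integral_add(2) i1 i2)
  have l1: "e1 \<longlonglongrightarrow> 0"
    by (rule real_tendsto_sandwich[OF _ _ tendsto_const sum]) (use e0 in \<open>auto intro!: always_eventually\<close>)
  have l2: "e2 \<longlonglongrightarrow> 0"
    by (rule real_tendsto_sandwich[OF _ _ tendsto_const sum]) (use e0 in \<open>auto intro!: always_eventually\<close>)
  define W where "W x = (LINT t:{- d / 2<..<x}|lborel. w t)" for x
  have sub: "{- d / 2<..<x} \<subseteq> ?I" if "x \<in> ?I" for x using that by (auto simp: Iv_def)
  have close: "\<bar>\<phi> n x - W x\<bar> \<le> t * d + e2 n / t" if x: "x \<in> ?I" and t: "t > 0" for n x t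
  proof -
    obtain c where c: "c < d / 2" "\<And>y. c \<le> \<bar>y\<bar> \<Longrightarrow> \<phi> n y = 0"
      using test_fun_support[OF \<phi>[of n] d] by metis
    have "\<phi> n (- d / 2) = 0" using c(1) d by (intro c(2)) simp
    have iw: "set_integrable lborel {- d / 2<..<x} w"
      using L2_on_integrable[OF Lw] sub[OF x] by - (rule set_integrable_subset, assumption, simp_all)
    have id: "set_integrable lborel {- d / 2<..<x} (deriv (\<phi> n))"
      using set_integrable_continuous_Iv[OF test_fun_continuous_deriv[OF \<phi>]] sub[OF x]
      by - (rule set_integrable_subset, assumption, simp_all)
    have "(LINT t:{- d / 2<..<x}|lborel. deriv (\<phi> n) t) = \<phi> n x - \<phi> n (- d / 2)"
    proof -
      have "- d / 2 \<le> x" using x by (auto simp: Iv_def)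
      then have "(LBINT t=ereal (- d / 2)..ereal x. deriv (\<phi> n) t) = \<phi> n x - \<phi> n (- d / 2)"
        by (intro interval_integral_FTC_finite test_fun_continuous_deriv[OF \<phi>])
          (auto simp: has_real_derivative_iff_has_vector_derivative[symmetric]
             intro: has_field_derivative_at_within test_fun_DERIV[OF \<phi>])
      then show ?thesis using \<open>- d / 2 \<le> x\<close>
        by (simp add: interval_lebesgue_integral_def einterval_eq)
    qed
    then have "\<phi> n x - W x = (LINT t:{- d / 2<..<x}|lborel. deriv (\<phi> n) t - w t)"
      unfolding W_def using iw id \<open>\<phi> n (- d / 2) = 0\<close> by simp
    also have "\<bar>\<dots>\<bar> \<le> (LINT t:{- d / 2<..<x}|lborel. \<bar>deriv (\<phi> n) t - w t\<bar>)"
      using set_integral_norm_bound[OF set_integral_diff(1)[OF id iw]] by simp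
    also have "\<dots> \<le> (LINT y:?I|lborel. \<bar>deriv (\<phi> n) y - w y\<bar>)"
    proof -
      have "set_integrable lborel ?I (\<lambda>y. \<bar>deriv (\<phi> n) y - w y\<bar>)"
        by (intro set_integrable_abs L2_on_integrable L2)
      moreover from this have "set_integrable lborel {- d / 2<..<x} (\<lambda>y. \<bar>deriv (\<phi> n) y - w y\<bar>)"
        by (rule set_integrable_subset) (use sub[OF x] in auto)
      ultimately show ?thesis
        unfolding set_lebesgue_integral_def set_integrable_def
        by (intro integral_mono) (use sub[OF x] in \<open>auto simp: indicator_def\<close>)
    qed
    also have "\<dots> \<le> (LINT y:?I|lborel. t + (1 / t) * (deriv (\<phi> n) y - w y)\<^sup>2)"
    proof (rule set_integral_mono)
      show "set_integrable lborel ?I (\<lambda>y. \<bar>deriv (\<phi> n) y - w y\<bar>)"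
        by (intro set_integrable_abs L2_on_integrable L2)
      show "set_integrable lborel ?I (\<lambda>y. t + (1 / t) * (deriv (\<phi> n) y - w y)\<^sup>2)"
        by (intro set_integral_add(1) set_integrable_const_Iv set_integrable_mult_right i2)
      have "\<bar>z\<bar> \<le> t + (1 / t) * z\<^sup>2" for z :: real
      proof -
        have "\<bar>z\<bar> * t \<le> t\<^sup>2 + z\<^sup>2"
          using zero_le_power2[of "\<bar>z\<bar> - t"] mult_nonneg_nonneg[OF abs_ge_zero[of z] less_imp_le[OF t]]
          unfolding power2_diff power2_abs by linarith
        then show ?thesis using t by (simp add: field_simps power2_eq_square)
      qed
      then show "\<bar>deriv (\<phi> n) y - w y\<bar> \<le> t + (1 / t) * (deriv (\<phi> n) y - w y)\<^sup>2" for y by blast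
    qed
    also have "\<dots> = t * d + e2 n / t"
    proof -
      have "(LINT y:?I|lborel. t) = t * d"
        using d by (simp add: Iv_def set_lebesgue_integral_def)
      moreover have "set_integrable lborel ?I (\<lambda>y. t)"
        by (rule set_integrable_const_Iv)
      ultimately show ?thesis
        using set_integral_add(2)[OF _ set_integrable_mult_right[OF i2, of "1 / t"], of "\<lambda>y. t" n]
        by (simp add: e2_def)
    qed
    finally show ?thesis .
  qed
  have unif: "eventually (\<lambda>n. \<forall>x\<in>?I. \<bar>\<phi> n x - W x\<bar> \<le> r) sequentially" if r: "r > 0" for r
  proof -
    define t where "t = r / (d + 1)"
    have t: "t > 0" using r d by (simp add: t_def)
    have "eventually (\<lambda>n. e2 n < t * t) sequentially"
      using order_tendstoD(2)[OF l2, of "t * t"] t by simp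
    then show ?thesis
    proof (rule eventually_mono, intro ballI)
      fix n x assume n: "e2 n < t * t" and x: "x \<in> ?I"
      have "\<bar>\<phi> n x - W x\<bar> \<le> t * d + e2 n / t" using x t by (rule close)
      also have "e2 n / t \<le> t" using n t by (simp add: divide_le_eq less_imp_le)
      also have "t * d + t = t * (d + 1)" by (simp add: algebra_simps)
      also have "\<dots> = r" using d by (simp add: t_def)
      finally show "\<bar>\<phi> n x - W x\<bar> \<le> r" by simp
    qed
  qed
  have "continuous_on ?I W"
  proof (rule uniform_limit_theorem)
    show "eventually (\<lambda>n. continuous_on ?I (\<phi> n)) sequentially"
      by (intro always_eventually allI test_fun_continuous[OF \<phi>])
    show "uniform_limit ?I \<phi> W sequentially"
      unfolding uniform_limit_iff dist_real_def
    proof (intro allI impI)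
      fix r :: real assume "r > 0"
      from unif[of "r / 2"] this show "\<forall>\<^sub>F n in sequentially. \<forall>x\<in>?I. \<bar>\<phi> n x - W x\<bar> < r"
        by (auto elim!: eventually_mono dest!: bspec)
    qed
  qed auto
  have W_v: "W x = v x" if x: "x \<in> ?I" for x
  proof -
    have cWv: "continuous_on ?I (\<lambda>x. W x - v x)" using \<open>continuous_on ?I W\<close> cv by (intro continuous_intros)
    obtain N where N: "\<And>x. x \<in> ?I \<Longrightarrow> \<bar>\<phi> N x - W x\<bar> \<le> 1"
      using unif[of 1] by (auto simp: eventually_sequentially)
    have LW: "L2_on ?I (\<lambda>x. \<phi> N x - W x)"
      unfolding L2_on_def
    proof
      show m: "set_borel_measurable lborel ?I (\<lambda>x. \<phi> N x - W x)"
        unfolding set_borel_measurable_Iv_iff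
        by (intro borel_measurable_continuous_on_restrict continuous_intros test_fun_continuous[OF \<phi>] \<open>continuous_on ?I W\<close>)
      have "set_borel_measurable lborel ?I (\<lambda>x. (\<phi> N x - W x)\<^sup>2)"
        using m unfolding set_borel_measurable_Iv_iff by measurable
      moreover have "\<bar>(\<phi> N x - W x)\<^sup>2\<bar> \<le> 1" if "x \<in> ?I" for x
        using N[OF that] by (simp add: abs_square_le_1)
      ultimately show "set_integrable lborel ?I (\<lambda>x. (\<phi> N x - W x)\<^sup>2)"
        by (rule set_integrable_bounded_Iv)
    qed
    have "L2_on ?I (\<lambda>x. (\<phi> N x - v x) - (\<phi> N x - W x))"
      using LW L2_on_diff[OF L2_on_continuous[OF test_fun_continuous[OF \<phi>]] Lv] by (rule L2_on_diff[rotated])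
    then have iWv: "set_integrable lborel ?I (\<lambda>x. (W x - v x)\<^sup>2)" by (simp add: L2_on_def)
    have "(LINT x:?I|lborel. (W x - v x)\<^sup>2) \<le> 0 + r" if r: "r > 0" for r
    proof -
      define t where "t = min 1 (r / (4 * d))"
      have t: "0 < t" "t \<le> 1" "t * d \<le> r / 4" using r d by (auto simp: t_def min_def field_simps)
      have "t * t \<le> t * 1" using t by (intro mult_left_mono) auto
      then have "t\<^sup>2 * d \<le> t * d" using d by (intro mult_right_mono) (auto simp: power2_eq_square)
      with t(3) have "t\<^sup>2 * d \<le> r / 4" by linarith
      have "eventually (\<lambda>n. e1 n < r / 4) sequentially"
        using order_tendstoD(2)[OF l1, of "r / 4"] r by simp
      with unif[OF t(1)] have "eventually (\<lambda>n. (\<forall>x\<in>?I. \<bar>\<phi> n x - W x\<bar> \<le> t) \<and> e1 n < r / 4) sequentially"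
        by eventually_elim auto
      then obtain n where n: "\<And>x. x \<in> ?I \<Longrightarrow> \<bar>\<phi> n x - W x\<bar> \<le> t" "e1 n < r / 4"
        by (auto simp: eventually_sequentially)
      have "(LINT x:?I|lborel. (W x - v x)\<^sup>2) \<le> (LINT x:?I|lborel. 2 * t\<^sup>2 + 2 * (\<phi> n x - v x)\<^sup>2)"
      proof (rule set_integral_mono[OF iWv])
        show "set_integrable lborel ?I (\<lambda>x. 2 * t\<^sup>2 + 2 * (\<phi> n x - v x)\<^sup>2)"
          by (intro set_integral_add(1) set_integrable_const_Iv set_integrable_mult_right i1)
        fix x assume "x \<in> ?I"
        then have "(\<phi> n x - W x)\<^sup>2 \<le> t\<^sup>2" using n(1)[of x] t(1) by (metis abs_le_square_iff abs_of_pos)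
        moreover have "(W x - v x)\<^sup>2 \<le> 2 * (\<phi> n x - W x)\<^sup>2 + 2 * (\<phi> n x - v x)\<^sup>2"
          using zero_le_power2[of "(\<phi> n x - W x) + (\<phi> n x - v x)"] by (simp add: power2_eq_square algebra_simps)
        ultimately show "(W x - v x)\<^sup>2 \<le> 2 * t\<^sup>2 + 2 * (\<phi> n x - v x)\<^sup>2" by linarith
      qed
      also have "\<dots> = 2 * t\<^sup>2 * d + 2 * e1 n"
      proof -
        have "(LINT y:?I|lborel. 2 * t\<^sup>2) = 2 * t\<^sup>2 * d"
          using d by (simp add: Iv_def set_lebesgue_integral_def)
        moreover have "set_integrable lborel ?I (\<lambda>y. 2 * t\<^sup>2)"
          by (rule set_integrable_const_Iv)
        ultimately show ?thesis
          using set_integral_add(2)[OF _ set_integrable_mult_right[OF i1, of 2], of "\<lambda>y. 2 * t\<^sup>2" n]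
          by (simp add: e1_def)
      qed
      also have "\<dots> \<le> 0 + r" using \<open>t\<^sup>2 * d \<le> r / 4\<close> n(2) by simp
      finally show ?thesis .
    qed
    then have "(LINT x:?I|lborel. (W x - v x)\<^sup>2) \<le> 0" by (rule field_le_epsilon)
    moreover have "(LINT x:?I|lborel. (W x - v x)\<^sup>2) \<ge> 0" by (rule set_integral_nonneg_Iv) simp
    ultimately have "(LINT x:?I|lborel. (W x - v x)\<^sup>2) = 0" by simp
    from continuous_zero_of_sq_integral_zero[OF cWv iWv this x] show ?thesis by simp
  qed
  have "eventually (\<lambda>n. e2 n < \<eta>) sequentially" using order_tendstoD(2)[OF l2 \<eta>] .
  with unif[OF \<eta>] have "eventually (\<lambda>n. (\<forall>x\<in>?I. \<bar>\<phi> n x - W x\<bar> \<le> \<eta>) \<and> e2 n < \<eta>) sequentially"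
    by eventually_elim auto
  then obtain n where "\<And>x. x \<in> ?I \<Longrightarrow> \<bar>\<phi> n x - W x\<bar> \<le> \<eta>" "e2 n < \<eta>"
    by (auto simp: eventually_sequentially)
  then show ?thesis using W_v \<phi> by (intro bexI[of _ "\<phi> n"]) (auto simp: e2_def)
qed

text \<open>
  A lower bound for the quotients of soft-thresholded test functions is a lower bound for
  \<open>\<lambda>\<^sub>1\<close>. In the hypothesis the full derivative of \<open>\<phi>\<close> is kept, although the
  thresholded function has a smaller one, so that no derivative of \<open>soft \<delta> \<circ> \<phi>\<close> is ever needed.
\<close>
lemma lambda1_geI:
  fixes \<psi> :: "real \<Rightarrow> ereal"
  defines "p \<equiv> \<lambda>x. real_of_ereal (\<psi> x)"
  assumes d: "0 < d" "d \<le> pi" and dom: "fin_dom \<psi> = Iv d" and pot: "is_potential \<psi> q"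
    and mono: "mono_on (Iv d) p" and \<Lambda>: "\<Lambda> \<ge> 0"
    and key: "\<And>\<mu> \<phi> \<delta>. has_distr_deriv (Iv d) p \<mu> \<Longrightarrow> \<phi> \<in> test_fun (Iv d) \<Longrightarrow> \<delta> > 0 \<Longrightarrow>
      \<Lambda> * (LINT x:Iv d|lborel. (soft \<delta> (\<phi> x))\<^sup>2) \<le>
        (LINT x:Iv d|lborel. (deriv \<phi> x)\<^sup>2) + (LINT x|\<mu>. (soft \<delta> (\<phi> x))\<^sup>2)
        + (LINT x:Iv d|lborel. (p x)\<^sup>2 * (soft \<delta> (\<phi> x))\<^sup>2)"
  shows "lambda1 (Iv d) q \<ge> ereal \<Lambda>"
  unfolding lambda1_def
proof (rule INF_greatest, clarify)
  let ?I = "Iv d"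
  fix v w x0
  assume H: "H10 ?I v w" and vq: "set_integrable q ?I (\<lambda>x. (v x)\<^sup>2)"
    and x0: "x0 \<in> ?I" "v x0 \<noteq> 0"
  from pot obtain \<mu> where \<mu>: "has_distr_deriv ?I p \<mu>" and q: "q = ext_potential \<psi> \<mu>"
    unfolding is_potential_def dom p_def by blast
  have pm: "p \<in> borel_measurable (restrict_space borel ?I)"
    using mono by (rule borel_measurable_mono_on_fnc)
  have sets_mu: "sets \<mu> = sets (restrict_space borel ?I)" using \<mu> by (simp add: has_distr_deriv_def)
  from H have cv: "continuous_on ?I v" and Lv: "L2_on ?I v" and Lw: "L2_on ?I w"
    by (auto simp: H10_def)
  have iv: "set_integrable lborel ?I (\<lambda>x. (v x)\<^sup>2)" and iw: "set_integrable lborel ?I (\<lambda>x. (w x)\<^sup>2)"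
    using Lv Lw by (auto simp: L2_on_def)
  define V where "V = (LINT x:?I|lborel. (v x)\<^sup>2)"
  define D where "D = (LINT x:?I|lborel. (w x)\<^sup>2)"
  define Q where "Q = (LINT x:?I|q. (v x)\<^sup>2)"
  have "V \<ge> 0" unfolding V_def by (rule set_integral_nonneg_Iv) simp
  moreover have "V \<noteq> 0"
    using continuous_zero_of_sq_integral_zero[OF cv iv _ x0(1)] x0(2) unfolding V_def by blast
  ultimately have V: "V > 0" by simp
  \<comment> \<open>Young's inequality with parameter \<open>\<eta>\<close> absorbs all approximation errors, whose squares are of size \<open>\<eta>\<^sup>2\<close>.\<close>
  have main: "\<Lambda> * V \<le> (1 + \<eta>) * ((1 + \<eta>) * D + (1 + 1 / \<eta>) * \<eta>\<^sup>2 + Q) + \<Lambda> * ((1 + 1 / \<eta>) * (4 * \<eta>\<^sup>2 * d))"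
    if \<eta>: "\<eta> > 0" for \<eta>
  proof -
    \<comment> \<open>The minimum serves both the uniform distance, at most \<open>\<eta>\<close>, and the squared \<open>L\<^sup>2\<close>-distance of the derivatives, at most \<open>\<eta>\<^sup>2\<close>.\<close>
    have "0 < min \<eta> (\<eta>\<^sup>2)" using \<eta> by simp
    then obtain \<phi> where \<phi>: "\<phi> \<in> test_fun ?I" and close0: "\<And>x. x \<in> ?I \<Longrightarrow> \<bar>\<phi> x - v x\<bar> \<le> min \<eta> (\<eta>\<^sup>2)"
      and L20: "(LINT x:?I|lborel. (deriv \<phi> x - w x)\<^sup>2) \<le> min \<eta> (\<eta>\<^sup>2)"
      using H10_uniform_approx[OF H d(1)] by blast
    have close: "\<bar>\<phi> x - v x\<bar> \<le> \<eta>" if "x \<in> ?I" for x using close0[OF that] by simp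
    have L2: "(LINT x:?I|lborel. (deriv \<phi> x - w x)\<^sup>2) \<le> \<eta>\<^sup>2" using L20 by simp
    define U where "U x = (soft \<eta> (\<phi> x))\<^sup>2" for x
    have U0: "U x \<ge> 0" for x by (simp add: U_def)
    have cU: "continuous_on A U" for A
      unfolding U_def by (intro continuous_intros test_fun_continuous[OF \<phi>])
    have Uv: "U x \<le> (v x)\<^sup>2" if "x \<in> ?I" for x
      unfolding U_def using soft_le[OF less_imp_le[OF \<eta>] close[OF that]] by (simp add: abs_le_square_iff)
    have iU: "integrable \<mu> U" unfolding U_def
      using \<eta> by (intro has_distr_deriv_comp(1)[OF \<mu> \<phi>, where g' = "\<lambda>z. 2 * soft \<eta> z"] DERIV_soft_sq continuous_intros) auto
    have ipU: "set_integrable lborel ?I (\<lambda>x. (p x)\<^sup>2 * U x)"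
    proof -
      obtain c where c: "0 < c" "c < d / 2" "\<And>y. c \<le> \<bar>y\<bar> \<Longrightarrow> \<phi> y = 0"
        using test_fun_support[OF \<phi> d(1)] by metis
      have mU: "U \<in> borel_measurable (restrict_space borel ?I)"
        by (intro measurable_restrict_space1 borel_measurable_continuous_onI cU)
      obtain B where B: "\<And>x. \<bar>x\<bar> \<le> c \<Longrightarrow> U x \<le> B"
      proof -
        have "compact (U ` {-c..c})" by (intro compact_continuous_image cU) auto
        then obtain B where "\<And>y. y \<in> U ` {-c..c} \<Longrightarrow> \<bar>y\<bar> \<le> B"
          using compact_imp_bounded by (metis bounded_real)
        note B = this
        have "U x \<le> B" if "\<bar>x\<bar> \<le> c" for x using B[of "U x"] that by (simp add: image_eqI abs_le_iff)
        then show ?thesis by (rule that)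
      qed
      define P where "P = max \<bar>p c\<bar> \<bar>p (- c)\<bar>"
      have P: "(p x)\<^sup>2 \<le> P\<^sup>2" if "\<bar>x\<bar> \<le> c" for x
      proof -
        have "p (- c) \<le> p x" "p x \<le> p c"
          using that c by (auto intro!: mono_onD[OF mono] simp: Iv_def)
        then have "\<bar>p x\<bar> \<le> P" by (auto simp: P_def)
        then show ?thesis using power_mono[of "\<bar>p x\<bar>" P 2] by simp
      qed
      have "\<bar>(p x)\<^sup>2 * U x\<bar> \<le> P\<^sup>2 * B" for x
      proof (cases "\<bar>x\<bar> \<le> c")
        case True
        have "(p x)\<^sup>2 * U x \<le> P\<^sup>2 * B" by (intro mult_mono P B True U0) auto
        then show ?thesis using U0[of x] by simp
      next
        case False
        then have "U x = 0" using c(3)[of x] \<eta> by (simp add: U_def)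
        moreover have "B \<ge> 0" using B[of 0] U0[of 0] c by simp
        ultimately show ?thesis by simp
      qed
      moreover have "set_borel_measurable lborel ?I (\<lambda>x. (p x)\<^sup>2 * U x)"
        unfolding set_borel_measurable_Iv_iff using pm mU by measurable
      ultimately show ?thesis by (intro set_integrable_bounded_Iv)
    qed
    have q_le: "(LINT x|\<mu>. U x) + (LINT x:?I|lborel. (p x)\<^sup>2 * U x) \<le> Q"
      unfolding Q_def q p_def
      by (rule potential_integral_ge[OF sets_mu dom d(2)])
        (use pm vq ipU iU U0 Uv in \<open>simp_all add: p_def q\<close>)
    have sU: "set_integrable lborel ?I U" by (intro set_integrable_continuous_Iv cU)
    define N where "N = (LINT x:?I|lborel. U x)"
    have d1: "(LINT x:?I|lborel. (deriv \<phi> x)\<^sup>2) \<le> (1 + \<eta>) * D + (1 + 1 / \<eta>) * \<eta>\<^sup>2"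
    proof -
      have i: "set_integrable lborel ?I (\<lambda>x. (deriv \<phi> x - w x)\<^sup>2)"
        using L2_on_diff[OF L2_on_continuous[OF test_fun_continuous_deriv[OF \<phi>]] Lw] by (simp add: L2_on_def)
      have "(LINT x:?I|lborel. (deriv \<phi> x)\<^sup>2) \<le>
        (LINT x:?I|lborel. (1 + \<eta>) * (w x)\<^sup>2 + (1 + 1 / \<eta>) * (deriv \<phi> x - w x)\<^sup>2)"
        by (intro set_integral_mono set_integral_add(1) set_integrable_mult_right iw i young_sq \<eta>
          set_integrable_continuous_Iv continuous_intros test_fun_continuous_deriv[OF \<phi>])
      also have "\<dots> = (1 + \<eta>) * D + (1 + 1 / \<eta>) * (LINT x:?I|lborel. (deriv \<phi> x - w x)\<^sup>2)"
        by (subst set_integral_add(2)) (auto intro!: iw i simp: D_def)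
      also have "\<dots> \<le> (1 + \<eta>) * D + (1 + 1 / \<eta>) * \<eta>\<^sup>2"
        using L2 \<eta> by (intro add_left_mono mult_left_mono) auto
      finally show ?thesis .
    qed
    have d2: "V \<le> (1 + \<eta>) * N + (1 + 1 / \<eta>) * (4 * \<eta>\<^sup>2 * d)"
    proof -
      have "V \<le> (LINT x:?I|lborel. (1 + \<eta>) * U x + (1 + 1 / \<eta>) * (4 * \<eta>\<^sup>2))"
        unfolding V_def
      proof (intro set_integral_mono set_integral_add(1) set_integrable_mult_right iv sU set_integrable_const_Iv)
        fix x assume "x \<in> ?I"
        then have "\<bar>v x - soft \<eta> (\<phi> x)\<bar> \<le> 2 * \<eta>"
          using close[of x] soft_close[of \<eta> "\<phi> x"] \<eta> by linarith
        then have "(v x - soft \<eta> (\<phi> x))\<^sup>2 \<le> (2 * \<eta>)\<^sup>2" using power_mono[of "\<bar>v x - soft \<eta> (\<phi> x)\<bar>" "2 * \<eta>" 2] by simp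
        then have "(1 + 1 / \<eta>) * (v x - soft \<eta> (\<phi> x))\<^sup>2 \<le> (1 + 1 / \<eta>) * (4 * \<eta>\<^sup>2)"
          using \<eta> by (intro mult_left_mono) (auto simp: power_mult_distrib)
        with young_sq[OF \<eta>, of "v x" "soft \<eta> (\<phi> x)"]
        show "(v x)\<^sup>2 \<le> (1 + \<eta>) * U x + (1 + 1 / \<eta>) * (4 * \<eta>\<^sup>2)" unfolding U_def by linarith
      qed
      also have "\<dots> = (1 + \<eta>) * N + (LINT x:?I|lborel. (1 + 1 / \<eta>) * (4 * \<eta>\<^sup>2))"
        by (subst set_integral_add(2)) (auto intro!: sU set_integrable_const_Iv simp: N_def)
      also have "(LINT x:?I|lborel. (1 + 1 / \<eta>) * (4 * \<eta>\<^sup>2)) = (1 + 1 / \<eta>) * (4 * \<eta>\<^sup>2 * d)"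
        using d by (simp add: Iv_def set_lebesgue_integral_def)
      finally show ?thesis .
    qed
    have "\<Lambda> * N \<le> (1 + \<eta>) * D + (1 + 1 / \<eta>) * \<eta>\<^sup>2 + Q"
      using key[OF \<mu> \<phi> \<eta>] d1 q_le unfolding N_def U_def by linarith
    then have "(1 + \<eta>) * (\<Lambda> * N) \<le> (1 + \<eta>) * ((1 + \<eta>) * D + (1 + 1 / \<eta>) * \<eta>\<^sup>2 + Q)"
      using \<eta> by (intro mult_left_mono) auto
    moreover have "\<Lambda> * V \<le> \<Lambda> * ((1 + \<eta>) * N + (1 + 1 / \<eta>) * (4 * \<eta>\<^sup>2 * d))"
      using d2 \<Lambda> by (rule mult_left_mono)
    moreover have "\<Lambda> * ((1 + \<eta>) * N + (1 + 1 / \<eta>) * (4 * \<eta>\<^sup>2 * d))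
       = (1 + \<eta>) * (\<Lambda> * N) + \<Lambda> * ((1 + 1 / \<eta>) * (4 * \<eta>\<^sup>2 * d))"
      by (simp only: distrib_left distrib_right ac_simps)
    ultimately show ?thesis by linarith
  qed
  have "\<Lambda> * V \<le> D + Q"
  proof (rule tendsto_lowerbound)
    show "((\<lambda>\<eta>. (1 + \<eta>) * ((1 + \<eta>) * D + (\<eta>\<^sup>2 + \<eta>) + Q) + \<Lambda> * (4 * (\<eta>\<^sup>2 + \<eta>) * d)) \<longlongrightarrow> D + Q) (at_right 0)"
      by (rule tendsto_eq_intros refl | simp)+
    show "eventually (\<lambda>\<eta>. \<Lambda> * V \<le> (1 + \<eta>) * ((1 + \<eta>) * D + (\<eta>\<^sup>2 + \<eta>) + Q) + \<Lambda> * (4 * (\<eta>\<^sup>2 + \<eta>) * d)) (at_right 0)"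
      using eventually_at_right_less[of 0]
    proof eventually_elim
      case (elim \<eta>)
      have e1: "(1 + 1 / \<eta>) * \<eta>\<^sup>2 = \<eta>\<^sup>2 + \<eta>" using elim by (simp add: field_simps power2_eq_square)
      have "(1 + 1 / \<eta>) * (4 * \<eta>\<^sup>2 * d) = 4 * ((1 + 1 / \<eta>) * \<eta>\<^sup>2) * d" by (simp only: ac_simps)
      then show ?case using main[OF elim] unfolding e1 by (simp only: mult.assoc)
    qed
  qed simp
  then have "\<Lambda> \<le> (D + Q) / V" using V by (simp add: field_simps)
  then show "ereal \<Lambda> \<le> ereal (((LINT x:?I|lborel. (w x)\<^sup>2) + (LINT x:?I|q. (v x)\<^sup>2)) / (LINT x:?I|lborel. (v x)\<^sup>2))"
    by (simp add: V_def D_def Q_def)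
qed

section \<open>The two-point inequality\<close>

text \<open>
  \<open>R\<close> sends \<open>z\<close> to the point \<open>R z\<close> such that \<open>\<rho>\<close> has as much mass between \<open>R z\<close> and \<open>b\<close> as between
  \<open>a\<close> and \<open>z\<close>: for a primitive \<open>F\<close> of \<open>\<rho>\<close>, the sum \<open>F z + F (R z)\<close> is constant. Its
  derivative says that \<open>R\<close> preserves the measure \<open>\<rho> dx\<close>.
\<close>
lemma mass_reversing_involution:
  fixes \<rho> :: "real \<Rightarrow> real"
  assumes cont: "continuous_on UNIV \<rho>" and \<epsilon>: "\<epsilon> > 0" "\<And>x. \<epsilon> \<le> \<rho> x"
  shows "\<exists>R. (\<forall>z. (R has_real_derivative - (\<rho> z / \<rho> (R z))) (at z)) \<and>
    (\<forall>z. R (R z) = z) \<and> (\<forall>y z. y \<le> z \<longrightarrow> R z \<le> R y) \<and> R a = b \<and> R b = a"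
proof -
  have pos: "\<rho> x > 0" for x using \<epsilon>(2)[of x] \<epsilon>(1) by linarith
  have "\<exists>F. \<forall>x :: real. (- \<infinity>) < ereal x \<longrightarrow> ereal x < \<infinity> \<longrightarrow> (F has_vector_derivative \<rho> x) (at x)"
    using cont by (intro einterval_antiderivative) (auto simp: continuous_on_eq_continuous_at)
  then obtain F where F: "\<And>x. (F has_real_derivative \<rho> x) (at x)"
    by (auto simp: has_real_derivative_iff_has_vector_derivative)
  have Fc: "isCont F x" for x using F by (rule DERIV_isCont)
  have grow: "F x + \<epsilon> * (y - x) \<le> F y" if "x \<le> y" for x y
  proof -
    have "F x - \<epsilon> * x \<le> F y - \<epsilon> * y"
      using that by (rule DERIV_nonneg_imp_nondecreasing)
        (auto intro!: exI derivative_eq_intros F simp: \<epsilon>(2))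
    then show ?thesis by (simp add: algebra_simps)
  qed
  have smono: "F x < F y" if "x < y" for x y
    using grow[of x y] that mult_pos_pos[OF \<epsilon>(1), of "y - x"] by linarith
  then have mono: "F x \<le> F y \<longleftrightarrow> x \<le> y" for x y
    by (metis le_less_linear linorder_not_less order_le_less)
  have inj: "inj F" by (rule injI) (metis smono less_irrefl linorder_neqE)
  have "surj F"
  proof (rule surjI)
    fix y
    define k where "k = \<bar>y - F 0\<bar> / \<epsilon>"
    have k: "k \<ge> 0" "\<epsilon> * k = \<bar>y - F 0\<bar>" using \<epsilon> by (auto simp: k_def)
    have "F (- k) \<le> y" "y \<le> F k" using grow[of "-k" 0] grow[of 0 k] k by auto
    then have "\<exists>x. - k \<le> x \<and> x \<le> k \<and> F x = y"
      using k Fc by (intro IVT) auto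
    then show "F (SOME x. F x = y) = y" by (metis (mono_tags) someI)
  qed
  define G where "G = inv F"
  have GF: "G (F x) = x" and FG: "F (G y) = y" for x y
    unfolding G_def using inj \<open>surj F\<close> by (auto simp: surj_f_inv_f)
  have "isCont G (F x)" for x
    by (rule isCont_inverse_function[of 1]) (auto simp: GF Fc)
  then have Gc: "isCont G y" for y using FG by metis
  have G: "(G has_real_derivative inverse (\<rho> (G y))) (at y)" for y
    using F pos[of "G y"] FG Gc by (intro DERIV_inverse_function[of F _ _ _ "y - 1" "y + 1"]) auto
  define R where "R z = G (F a + F b - F z)" for z
  show ?thesis
  proof (intro exI[of _ R] conjI allI impI)
    show "(R has_real_derivative - (\<rho> z / \<rho> (R z))) (at z)" for z
    proof -
      have "((\<lambda>z. F a + F b - F z) has_real_derivative - \<rho> z) (at z)"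
        by (auto intro!: derivative_eq_intros F)
      from DERIV_chain2[OF G this] show ?thesis
        unfolding R_def by (simp add: field_simps)
    qed
    show "R (R z) = z" for z by (simp add: R_def FG GF)
    show "R z \<le> R y" if "y \<le> z" for y z
    proof -
      have "F y \<le> F z" using that mono by blast
      then have "F (R z) \<le> F (R y)" by (simp add: R_def FG)
      then show ?thesis using mono by blast
    qed
    show "R a = b" "R b = a" by (simp_all add: R_def GF)
  qed
qed

lemma mono_on_mult_absolutely_integrable:
  fixes p h :: "real \<Rightarrow> real"
  assumes "mono_on {a..b} p" "h absolutely_integrable_on {a..b}"
  shows "(\<lambda>x. p x * h x) absolutely_integrable_on {a..b}"
proof (rule absolutely_integrable_bounded_measurable_product_real)
  show "p \<in> borel_measurable (lebesgue_on {a..b})"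
    using integrable_mono_on[OF assms(1)] by (rule borel_measurable_integrable)
  have "\<bar>p x\<bar> \<le> max \<bar>p a\<bar> \<bar>p b\<bar>" if "x \<in> {a..b}" for x
  proof -
    have "p a \<le> p x" "p x \<le> p b" using that by (auto intro!: mono_onD[OF assms(1)])
    then show ?thesis by auto
  qed
  then have "\<forall>y\<in>p ` {a..b}. norm y \<le> max \<bar>p a\<bar> \<bar>p b\<bar>" by auto
  then show "bounded (p ` {a..b})" unfolding bounded_iff by blast
qed (use assms in auto)

text \<open>
  The heart of the proof. Pair each \<open>z\<close> with its mass-reversed partner \<open>R z\<close> and put
  \<open>s z = S ((z - R z) / 2)\<close>, which is odd under the exchange of partners. Writing \<open>t\<close> for the
  half-distance and \<open>\<theta> = \<rho> z / \<rho> (R z)\<close>, the values of \<open>s' + 2 p s - s\<^sup>2\<close> at the two partners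
  add up to
  \<open>S' t * ((1 + \<theta>) / 2 + (1 + 1 / \<theta>) / 2) + 2 * (p z - p (R z)) * S t - 2 * (S t)\<^sup>2\<close>.
  The first bracket is at least 2, and \<open>p\<close> enters only through a difference, which the modulus
  \<open>G\<close> bounds below; so the sum is at least \<open>2 * \<Lambda>\<close>. As \<open>R\<close> preserves \<open>\<rho> dx\<close>,
  integrating against \<open>\<rho>\<close> gives the claim.

  The density \<open>U\<close> may vanish, whereas \<open>R\<close> needs a positive one. Hence \<open>\<rho> = U + \<epsilon>\<close>, at the price of
  an error \<open>\<epsilon> * C\<close> where \<open>C\<close> does not depend on \<open>\<epsilon>\<close>.
\<close>
lemma two_point_inequality:
  fixes p S S' G U :: "real \<Rightarrow> real"
  assumes d: "0 < d" and mono: "mono_on (Iv d) p"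
    and odd: "\<And>t. S (- t) = - S t"
    and dS: "\<And>t. t \<in> Iv d \<Longrightarrow> (S has_real_derivative S' t) (at t)"
    and cS': "continuous_on (Iv d) S'" and S'0: "\<And>t. t \<in> Iv d \<Longrightarrow> 0 \<le> S' t"
    and sep: "\<And>x y. x \<in> Iv d \<Longrightarrow> y \<in> Iv d \<Longrightarrow> x < y \<Longrightarrow> G ((y - x) / 2) \<le> p y - p x"
    and ode: "\<And>t. 0 \<le> t \<Longrightarrow> t < d / 2 \<Longrightarrow> \<Lambda> \<le> S' t + S t * G t - (S t)\<^sup>2"
    and \<Lambda>: "0 \<le> \<Lambda>"
    and c: "0 < c" "c < d / 2" and cU: "continuous_on UNIV U" and U0: "\<And>x. 0 \<le> U x"
    and \<epsilon>: "\<epsilon> > 0"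
  defines "C \<equiv> 2 * S c + 4 * c * max \<bar>p (- c)\<bar> \<bar>p c\<bar> * S c"
  shows "\<exists>s s'. (\<forall>x\<in>{-c..c}. (s has_real_derivative s' x) (at x)) \<and> continuous_on {-c..c} s' \<and>
    \<Lambda> * integral {-c..c} U \<le> integral {-c..c} (\<lambda>x. U x * (s' x + 2 * p x * s x - (s x)\<^sup>2)) + \<epsilon> * C"
proof -
  let ?J = "{-c..c}"
  have J: "x \<in> Iv d" if "x \<in> ?J" for x using that c by (auto simp: Iv_def)
  define \<rho> where "\<rho> x = U x + \<epsilon>" for x
  have c\<rho>: "continuous_on A \<rho>" for A
    unfolding \<rho>_def by (intro continuous_intros continuous_on_subset[OF cU]) auto
  have pos: "\<rho> x > 0" for x using U0[of x] \<epsilon> by (simp add: \<rho>_def)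
  have \<rho>\<epsilon>: "\<epsilon> \<le> \<rho> x" for x using U0 by (simp add: \<rho>_def)
  obtain R where dR: "\<And>z. (R has_real_derivative - (\<rho> z / \<rho> (R z))) (at z)"
    and RR: "\<And>z. R (R z) = z" and Rmono: "\<And>y z. y \<le> z \<Longrightarrow> R z \<le> R y" and Rc: "R (- c) = c" "R c = - c"
    using mass_reversing_involution[OF c\<rho> \<epsilon> \<rho>\<epsilon>, of "-c" c] by metis
  have RJ: "R z \<in> ?J" if "z \<in> ?J" for z using that Rmono[of "-c" z] Rmono[of z c] Rc by auto
  have Rim: "R ` ?J = ?J"
  proof
    show "R ` ?J \<subseteq> ?J" using RJ by blast
    show "?J \<subseteq> R ` ?J"
    proof
      fix x assume "x \<in> ?J"
      then have "R (R x) \<in> R ` ?J" using RJ by (intro imageI)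
      then show "x \<in> R ` ?J" unfolding RR .
    qed
  qed
  have cR: "continuous_on A R" for A using dR by (meson DERIV_isCont continuous_at_imp_continuous_on)
  have even: "S' (- t) = S' t" if "t \<in> Iv d" for t
  proof -
    have "- t \<in> Iv d" using that by (auto simp: Iv_def)
    then have "((\<lambda>t. S (- t)) has_real_derivative S' (- t) * (- 1)) (at t)"
      by (intro DERIV_chain2[OF dS]) (auto intro!: derivative_eq_intros)
    then have "((\<lambda>t. - S t) has_real_derivative - S' (- t)) (at t)" by (simp add: odd)
    moreover have "((\<lambda>t. - S t) has_real_derivative - S' t) (at t)" by (intro DERIV_minus dS that)
    ultimately show ?thesis using DERIV_unique by fastforce
  qed
  have S0: "S 0 = 0" using odd[of 0] by simp
  have Smono: "S x \<le> S y" if "x \<in> Iv d" "y \<in> Iv d" "x \<le> y" for x y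
    using that(3)
  proof (rule DERIV_nonneg_imp_nondecreasing)
    fix z assume "x \<le> z" "z \<le> y"
    then have "z \<in> Iv d" using that by (auto simp: Iv_def)
    then show "\<exists>D. (S has_real_derivative D) (at z) \<and> 0 \<le> D" using dS S'0 by blast
  qed
  have cS: "continuous_on (Iv d) S" using dS by (meson DERIV_isCont continuous_at_imp_continuous_on)
  define t where "t z = (z - R z) / 2" for z
  have tJ: "t z \<in> ?J" if "z \<in> ?J" for z using RJ[OF that] that by (auto simp: t_def)
  have tR: "t (R z) = - t z" for z by (simp add: t_def RR field_simps)
  define s where "s z = S (t z)" for z
  define s' where "s' z = S' (t z) * ((1 + \<rho> z / \<rho> (R z)) / 2)" for z
  have ds: "(s has_real_derivative s' z) (at z)" if "z \<in> ?J" for z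
    unfolding s_def s'_def
  proof (rule DERIV_chain2[OF dS])
    show "t z \<in> Iv d" using tJ[OF that] by (rule J)
    have "(t has_real_derivative (1 - - (\<rho> z / \<rho> (R z))) / 2) (at z)"
      unfolding t_def by (intro DERIV_cdivide DERIV_diff DERIV_ident dR)
    then show "(t has_real_derivative (1 + \<rho> z / \<rho> (R z)) / 2) (at z)" by simp
  qed
  have ct: "continuous_on ?J t" unfolding t_def by (intro continuous_intros cR) simp
  have tim: "t ` ?J \<subseteq> Iv d" using tJ J by blast
  have cq: "continuous_on ?J (\<lambda>z. \<rho> z / \<rho> (R z))"
  proof (rule continuous_on_divide[OF c\<rho>])
    show "continuous_on ?J (\<lambda>z. \<rho> (R z))" by (rule continuous_on_compose2[OF c\<rho>[of UNIV] cR]) simp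
    show "\<forall>z\<in>?J. \<rho> (R z) \<noteq> 0" using pos less_irrefl by metis
  qed
  have cs': "continuous_on ?J s'"
    unfolding s'_def
    by (intro continuous_on_mult continuous_on_compose2[OF cS' ct tim] continuous_on_divide
        continuous_on_add continuous_on_const cq) simp
  have cs: "continuous_on ?J s" unfolding s_def by (intro continuous_on_compose2[OF cS ct tim])
  have pJ: "mono_on ?J p" using mono J by (auto intro: mono_on_subset)
  define \<Phi> where "\<Phi> z = s' z + 2 * p z * s z - (s z)\<^sup>2" for z
  have i\<Phi>: "(\<lambda>z. h z * \<Phi> z) absolutely_integrable_on ?J" if h: "continuous_on ?J h" for h
  proof -
    have "(\<lambda>z. p z * (2 * h z * s z)) absolutely_integrable_on ?J"
      by (intro mono_on_mult_absolutely_integrable pJ absolutely_integrable_continuous_real continuous_intros h cs)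
    moreover have "(\<lambda>z. h z * (s' z - (s z)\<^sup>2)) absolutely_integrable_on ?J"
      by (intro absolutely_integrable_continuous_real continuous_intros h cs cs')
    ultimately have "(\<lambda>z. p z * (2 * h z * s z) + h z * (s' z - (s z)\<^sup>2)) absolutely_integrable_on ?J"
      by (rule set_integral_add(1))
    moreover have "p z * (2 * h z * s z) + h z * (s' z - (s z)\<^sup>2) = h z * \<Phi> z" for z
      by (simp add: \<Phi>_def algebra_simps)
    ultimately show ?thesis by simp
  qed
  \<comment> \<open>The right-hand side is symmetric in the two partners, so it suffices to treat the right one of them.\<close>
  have pw0: "2 * \<Lambda> \<le> \<Phi> z + \<Phi> (R z)" if z: "z \<in> ?J" and tz: "t z \<ge> 0" for z
  proof -
    define \<theta> where "\<theta> = \<rho> z / \<rho> (R z)"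
    have \<theta>: "\<theta> > 0" using pos by (simp add: \<theta>_def)
    have tI: "t z \<in> Iv d" using tJ[OF z] by (rule J)
    have s1: "s (R z) = - s z" by (simp add: s_def tR odd)
    have s'1: "s' (R z) = S' (t z) * ((1 + inverse \<theta>) / 2)"
      by (simp add: s'_def tR even[OF tI] RR \<theta>_def)
    have "0 \<le> (\<theta> - 1)\<^sup>2 / \<theta>" using \<theta> by simp
    also have "(\<theta> - 1)\<^sup>2 / \<theta> = \<theta> + inverse \<theta> - 2" using \<theta> by (simp add: field_simps power2_eq_square)
    finally have "2 \<le> (1 + \<theta>) / 2 + (1 + inverse \<theta>) / 2" by argo
    then have "S' (t z) * 2 \<le> S' (t z) * ((1 + \<theta>) / 2 + (1 + inverse \<theta>) / 2)"
      using S'0[OF tI] by (rule mult_left_mono)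
    then have a: "2 * S' (t z) \<le> s' z + s' (R z)" unfolding s'1 by (simp add: s'_def \<theta>_def distrib_left)
    have b: "S (t z) * G (t z) \<le> (p z - p (R z)) * s z"
    proof (cases "t z = 0")
      case False
      have "S 0 \<le> S (t z)" using tz tI d by (intro Smono) (auto simp: Iv_def)
      then have "S (t z) \<ge> 0" by (simp add: S0)
      moreover have "G (t z) \<le> p z - p (R z)"
        unfolding t_def by (intro sep J RJ z) (use False tz in \<open>auto simp: t_def\<close>)
      ultimately have "S (t z) * G (t z) \<le> S (t z) * (p z - p (R z))" by (intro mult_left_mono)
      then show ?thesis by (simp add: s_def mult.commute)
    qed (simp add: s_def S0)
    have "\<Lambda> \<le> S' (t z) + S (t z) * G (t z) - (S (t z))\<^sup>2"
      using tz tI by (intro ode) (auto simp: Iv_def)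
    moreover have "\<Phi> z + \<Phi> (R z) = s' z + s' (R z) + 2 * ((p z - p (R z)) * s z) - 2 * (s z)\<^sup>2"
      unfolding \<Phi>_def s1 by (simp add: algebra_simps)
    ultimately show ?thesis using a b by (simp add: s_def)
  qed
  have pw: "2 * \<Lambda> \<le> \<Phi> z + \<Phi> (R z)" if z: "z \<in> ?J" for z
  proof (cases "t z \<ge> 0")
    case False
    then show ?thesis using pw0[OF RJ[OF z]] by (simp add: tR RR)
  qed (use pw0 z in blast)
  have i\<rho>: "(\<lambda>z. \<rho> z * \<Phi> z) absolutely_integrable_on ?J" by (intro i\<Phi> c\<rho>)
  have cov: "(\<lambda>z. \<bar>- (\<rho> z / \<rho> (R z))\<bar> * (\<rho> (R z) * \<Phi> (R z))) absolutely_integrable_on ?J \<and>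
      integral ?J (\<lambda>z. \<bar>- (\<rho> z / \<rho> (R z))\<bar> * (\<rho> (R z) * \<Phi> (R z))) = integral ?J (\<lambda>z. \<rho> z * \<Phi> z)"
  proof -
    have inj: "inj_on R ?J" using RR by (metis inj_onI)
    have der: "(R has_real_derivative - (\<rho> z / \<rho> (R z))) (at z within ?J)" for z
      using dR by (rule has_field_derivative_at_within)
    have "?J \<in> sets lebesgue" by simp
    from has_absolute_integral_change_of_variables_1'[OF this der inj, of "\<lambda>z. \<rho> z * \<Phi> z" "integral ?J (\<lambda>z. \<rho> z * \<Phi> z)"]
    show ?thesis using i\<rho> unfolding Rim by blast
  qed
  have eqR: "\<bar>- (\<rho> z / \<rho> (R z))\<bar> * (\<rho> (R z) * \<Phi> (R z)) = \<rho> z * \<Phi> (R z)" for z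
    using pos[of z] pos[of "R z"] by (simp add: field_simps)
  have i\<rho>R: "(\<lambda>z. \<rho> z * \<Phi> (R z)) absolutely_integrable_on ?J"
    and eqI: "integral ?J (\<lambda>z. \<rho> z * \<Phi> (R z)) = integral ?J (\<lambda>z. \<rho> z * \<Phi> z)"
    using cov unfolding eqR by auto
  note io = set_lebesgue_integral_eq_integral(1)
  have iUc: "(\<lambda>z. h z) integrable_on ?J" if "continuous_on ?J h" for h :: "real \<Rightarrow> real"
    using that by (rule integrable_continuous_real)
  have cUJ: "continuous_on ?J U" using cU by (rule continuous_on_subset) auto
  have 1: "\<Lambda> * integral ?J \<rho> \<le> integral ?J (\<lambda>z. \<rho> z * \<Phi> z)"
  proof -
    have "integral ?J (\<lambda>z. 2 * \<Lambda> * \<rho> z) \<le> integral ?J (\<lambda>z. \<rho> z * \<Phi> z + \<rho> z * \<Phi> (R z))"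
    proof (rule integral_le)
      show "(\<lambda>z. 2 * \<Lambda> * \<rho> z) integrable_on ?J" by (intro iUc continuous_intros c\<rho>)
      show "(\<lambda>z. \<rho> z * \<Phi> z + \<rho> z * \<Phi> (R z)) integrable_on ?J"
        by (intro integrable_add io i\<rho> i\<rho>R)
      fix z assume "z \<in> ?J"
      from mult_left_mono[OF pw[OF this] less_imp_le[OF pos[of z]]]
      show "2 * \<Lambda> * \<rho> z \<le> \<rho> z * \<Phi> z + \<rho> z * \<Phi> (R z)" by (simp add: algebra_simps)
    qed
    also have "\<dots> = 2 * integral ?J (\<lambda>z. \<rho> z * \<Phi> z)"
      by (subst integral_add) (auto intro: io i\<rho> i\<rho>R simp: eqI)
    finally show ?thesis by simp
  qed
  have 2: "integral ?J \<rho> \<ge> integral ?J U"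
    using \<epsilon> by (intro integral_le iUc c\<rho> cUJ) (simp add: \<rho>_def)
  have i1: "\<Phi> absolutely_integrable_on ?J" using i\<Phi>[of "\<lambda>_. 1"] by simp
  have 3: "integral ?J (\<lambda>z. \<rho> z * \<Phi> z) = integral ?J (\<lambda>z. U z * \<Phi> z) + \<epsilon> * integral ?J \<Phi>"
  proof -
    have "integral ?J (\<lambda>z. \<rho> z * \<Phi> z) = integral ?J (\<lambda>z. U z * \<Phi> z + \<epsilon> * \<Phi> z)"
      by (simp add: \<rho>_def distrib_right)
    also have "\<dots> = integral ?J (\<lambda>z. U z * \<Phi> z) + integral ?J (\<lambda>z. \<epsilon> * \<Phi> z)"
      by (intro integral_add io i\<Phi> cUJ continuous_on_const)
    finally show ?thesis by simp
  qed
  \<comment> \<open>The derivative \<open>s'\<close> itself may be large where \<open>U\<close> is small, but its integral is \<open>2 * S c\<close>.\<close>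
  have 4: "integral ?J \<Phi> \<le> C"
  proof -
    define B where "B = max \<bar>p (- c)\<bar> \<bar>p c\<bar>"
    have sc: "s c = S c" "s (- c) = - S c" by (simp_all add: s_def t_def Rc odd)
    have Is': "(s' has_integral s c - s (- c)) ?J"
      using c ds by (intro fundamental_theorem_of_calculus)
        (auto simp: has_real_derivative_iff_has_vector_derivative[symmetric] intro: has_field_derivative_at_within)
    have "integral ?J \<Phi> \<le> integral ?J (\<lambda>z. s' z + 2 * B * S c)"
    proof (rule integral_le)
      show "\<Phi> integrable_on ?J" using i1 by (rule io)
      show "(\<lambda>z. s' z + 2 * B * S c) integrable_on ?J" by (intro iUc continuous_intros cs')
      fix z assume z: "z \<in> ?J"
      have "p (- c) \<le> p z" "p z \<le> p c" using z c by (auto intro!: mono_onD[OF pJ])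
      then have pB: "\<bar>p z\<bar> \<le> B" by (auto simp: B_def)
      have cc: "c \<in> Iv d" "- c \<in> Iv d" using c by (auto simp: J)
      have "S (- c) \<le> s z" "s z \<le> S c" unfolding s_def using tJ[OF z]
        by (auto intro!: Smono J cc)
      then have sB: "\<bar>s z\<bar> \<le> S c" by (auto simp: odd)
      have "p z * s z \<le> \<bar>p z\<bar> * \<bar>s z\<bar>" by (simp flip: abs_mult)
      also have "\<dots> \<le> B * S c" using pB sB by (intro mult_mono) auto
      finally have "p z * s z \<le> B * S c" .
      moreover have "(s z)\<^sup>2 \<ge> 0" by simp
      ultimately show "\<Phi> z \<le> s' z + 2 * B * S c" unfolding \<Phi>_def by linarith
    qed
    also have "\<dots> = (s c - s (- c)) + integral ?J (\<lambda>z. 2 * B * S c)"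
      using Is' by (subst integral_add) (auto simp: has_integral_iff)
    also have "\<dots> = C" using c by (simp add: sc C_def B_def)
    finally show ?thesis .
  qed
  have "\<Lambda> * integral ?J U \<le> \<Lambda> * integral ?J \<rho>" using 2 \<Lambda> by (rule mult_left_mono)
  also have "\<dots> \<le> integral ?J (\<lambda>z. U z * \<Phi> z) + \<epsilon> * C"
    using 1 3 mult_left_mono[OF 4, of \<epsilon>] \<epsilon> by linarith
  finally show ?thesis using ds cs' unfolding \<Phi>_def by blast
qed

text \<open>
  For \<open>u = soft \<delta> \<circ> \<phi>\<close> and \<open>U = u\<^sup>2\<close>, the square \<open>(\<phi>' - p u + s u)\<^sup>2\<close> is nonnegative. Since \<open>\<mu>\<close> is the
  derivative of \<open>p\<close>, the cross term \<open>- 2 p u \<phi>' = - p U'\<close> integrates to the \<open>\<mu>\<close>-integral of \<open>U\<close>, and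
  \<open>2 s u \<phi>' = s U'\<close> integrates to minus the integral of \<open>s' U\<close>. What remains is the left-hand side
  of the two-point inequality.
\<close>
lemma lambda1_ge_of_modulus:
  fixes \<psi> :: "real \<Rightarrow> ereal" and S S' G :: "real \<Rightarrow> real"
  defines "p \<equiv> \<lambda>x. real_of_ereal (\<psi> x)"
  assumes d: "0 < d" "d \<le> pi" and dom: "fin_dom \<psi> = Iv d" and pot: "is_potential \<psi> q"
    and mono: "mono_on (Iv d) p"
    and odd: "\<And>t. S (- t) = - S t"
    and dS: "\<And>t. t \<in> Iv d \<Longrightarrow> (S has_real_derivative S' t) (at t)"
    and cS': "continuous_on (Iv d) S'" and S'0: "\<And>t. t \<in> Iv d \<Longrightarrow> 0 \<le> S' t"
    and sep: "\<And>x y. x \<in> Iv d \<Longrightarrow> y \<in> Iv d \<Longrightarrow> x < y \<Longrightarrow> G ((y - x) / 2) \<le> p y - p x"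
    and ode: "\<And>t. 0 \<le> t \<Longrightarrow> t < d / 2 \<Longrightarrow> \<Lambda> \<le> S' t + S t * G t - (S t)\<^sup>2"
    and \<Lambda>: "0 \<le> \<Lambda>"
  shows "lambda1 (Iv d) q \<ge> ereal \<Lambda>"
proof (rule lambda1_geI[OF d dom pot mono[unfolded p_def] \<Lambda>])
  fix \<mu> \<phi> and \<delta> :: real
  assume \<mu>0: "has_distr_deriv (Iv d) (\<lambda>x. real_of_ereal (\<psi> x)) \<mu>" and \<phi>: "\<phi> \<in> test_fun (Iv d)" and \<delta>: "\<delta> > 0"
  note \<mu> = \<mu>0[folded p_def]
  obtain c where c: "0 < c" "c < d / 2" and supp: "\<And>x. c \<le> \<bar>x\<bar> \<Longrightarrow> \<phi> x = 0"
    using test_fun_support[OF \<phi> d(1)] by metis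
  let ?J = "{-c..c}"
  have sub: "?J \<subseteq> Iv d" using c by (auto simp: Iv_def)
  have pJ: "mono_on ?J p" using mono sub by (rule mono_on_subset)
  define U where "U x = (soft \<delta> (\<phi> x))\<^sup>2" for x
  define U' where "U' x = 2 * soft \<delta> (\<phi> x) * deriv \<phi> x" for x
  have cU: "continuous_on A U" for A
    unfolding U_def by (intro continuous_intros test_fun_continuous[OF \<phi>])
  have cU': "continuous_on A U'" for A
    unfolding U'_def by (intro continuous_intros test_fun_continuous[OF \<phi>] test_fun_continuous_deriv[OF \<phi>])
  have c\<phi>': "continuous_on A (deriv \<phi>)" for A by (rule test_fun_continuous_deriv[OF \<phi>])
  have U0: "U x \<ge> 0" for x by (simp add: U_def)
  have dU: "(U has_real_derivative U' x) (at x)" for x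
    unfolding U_def U'_def using \<delta>
    by (intro DERIV_chain2[OF DERIV_soft_sq test_fun_DERIV[OF \<phi>]]) simp
  have Uz: "U x = 0" "U' x = 0" if "c \<le> \<bar>x\<bar>" for x using supp[OF that] \<delta> by (simp_all add: U_def U'_def)
  have \<phi>'z: "deriv \<phi> x = 0" if "c < \<bar>x\<bar>" for x
  proof -
    have "open {x. c < \<bar>x\<bar>}" by (intro open_Collect_less continuous_intros)
    then have "eventually (\<lambda>y. y \<in> {x. c < \<bar>x\<bar>}) (nhds x)" using that by (intro eventually_nhds_in_open) auto
    then have "eventually (\<lambda>y. \<phi> y = 0) (nhds x)" by eventually_elim (auto intro: supp)
    then have "deriv \<phi> x = deriv (\<lambda>_. 0) x" by (rule deriv_cong_ev) simp
    then show ?thesis by simp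
  qed
  note io = set_lebesgue_integral_eq_integral(1)
  have toJ: "(LINT x:Iv d|lborel. f x) = integral ?J f"
    if f: "set_integrable lborel ?J f" "\<And>x. c < \<bar>x\<bar> \<Longrightarrow> f x = 0" for f :: "real \<Rightarrow> real"
  proof -
    have "(LINT x:Iv d|lborel. f x) = (LINT x:?J|lborel. f x)"
      unfolding set_lebesgue_integral_def
    proof (intro Bochner_Integration.integral_cong refl)
      fix x show "indicator (Iv d) x *\<^sub>R f x = indicator ?J x *\<^sub>R f x"
      proof (cases "x \<in> ?J")
        case False
        then have "c < \<bar>x\<bar>" by auto
        then show ?thesis by (simp add: f(2))
      qed (use sub in auto)
    qed
    also have "\<dots> = integral ?J f" using f(1) by (rule set_borel_integral_eq_integral)
    finally show ?thesis .
  qed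
  have cJ: "set_integrable lborel ?J f" if "continuous_on UNIV f" for f :: "real \<Rightarrow> real"
    using that by (intro borel_integrable_atLeastAtMost') (auto intro: continuous_on_subset)
  have pcJ: "set_integrable lborel ?J (\<lambda>x. p x * f x)" "set_integrable lborel ?J (\<lambda>x. (p x)\<^sup>2 * f x)"
    if "continuous_on UNIV f" for f
  proof -
    define P where "P x = p (max (- c) (min c x))" for x
    have "mono P" unfolding P_def using c by (intro monoI mono_onD[OF pJ]) auto
    then have [measurable]: "P \<in> borel_measurable borel" by (rule borel_measurable_mono)
    have PB: "\<bar>P x\<bar> \<le> max \<bar>p (- c)\<bar> \<bar>p c\<bar>" for x
    proof -
      have "p (- c) \<le> P x" "P x \<le> p c" unfolding P_def using c by (auto intro!: mono_onD[OF pJ])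
      then show ?thesis by auto
    qed
    have [measurable]: "f \<in> borel_measurable borel" using that by (rule borel_measurable_continuous_onI)
    have "set_integrable lborel ?J (\<lambda>x. P x * f x)"
    proof (rule set_integrable_bound[OF set_integrable_mult_right[OF cJ[OF that], of "max \<bar>p (- c)\<bar> \<bar>p c\<bar>"]])
      show "AE x in lborel. x \<in> ?J \<longrightarrow> norm (P x * f x) \<le> norm (max \<bar>p (- c)\<bar> \<bar>p c\<bar> * f x)"
        unfolding real_norm_def abs_mult using PB by (intro AE_I2 impI mult_right_mono) (auto simp: abs_le_iff)
    qed (simp add: set_borel_measurable_def)
    moreover have "set_integrable lborel ?J (\<lambda>x. (P x)\<^sup>2 * f x)"
    proof (rule set_integrable_bound[OF set_integrable_mult_right[OF cJ[OF that], of "(max \<bar>p (- c)\<bar> \<bar>p c\<bar>)\<^sup>2"]])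
      show "AE x in lborel. x \<in> ?J \<longrightarrow> norm ((P x)\<^sup>2 * f x) \<le> norm ((max \<bar>p (- c)\<bar> \<bar>p c\<bar>)\<^sup>2 * f x)"
        unfolding real_norm_def abs_mult using power_mono[OF PB abs_ge_zero, of _ 2]
        by (intro AE_I2 impI mult_right_mono) auto
    qed (simp add: set_borel_measurable_def)
    moreover have P: "P x = p x" if "x \<in> ?J" for x using that by (simp add: P_def)
    have "set_integrable lborel ?J (\<lambda>x. P x * f x) = set_integrable lborel ?J (\<lambda>x. p x * f x)"
      "set_integrable lborel ?J (\<lambda>x. (P x)\<^sup>2 * f x) = set_integrable lborel ?J (\<lambda>x. (p x)\<^sup>2 * f x)"
      by (intro set_integrable_cong refl, simp only: P)+
    ultimately show "set_integrable lborel ?J (\<lambda>x. p x * f x)" "set_integrable lborel ?J (\<lambda>x. (p x)\<^sup>2 * f x)"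
      by simp_all
  qed
  have mu: "(LINT x|\<mu>. U x) = - integral ?J (\<lambda>x. p x * U' x)"
  proof -
    have "(LINT x|\<mu>. U x) = - (LINT x:Iv d|lborel. p x * ((2 * soft \<delta> (\<phi> x)) * deriv \<phi> x))"
      unfolding U_def using \<delta>
      by (intro has_distr_deriv_comp(3)[OF \<mu> \<phi>, where g' = "\<lambda>z. 2 * soft \<delta> z"] DERIV_soft_sq continuous_intros) auto
    also have "(\<lambda>x. p x * ((2 * soft \<delta> (\<phi> x)) * deriv \<phi> x)) = (\<lambda>x. p x * U' x)" by (simp add: U'_def)
    also have "(LINT x:Iv d|lborel. p x * U' x) = integral ?J (\<lambda>x. p x * U' x)"
      by (intro toJ pcJ cU') (simp add: Uz)
    finally show ?thesis .
  qed
  define C where "C = 2 * S c + 4 * c * max \<bar>p (- c)\<bar> \<bar>p c\<bar> * S c"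
  define A where "A = integral ?J (\<lambda>x. (deriv \<phi> x)\<^sup>2)"
  define B where "B = integral ?J (\<lambda>x. (p x)\<^sup>2 * U x)"
  define X where "X = integral ?J (\<lambda>x. p x * U' x)"
  have "\<Lambda> * integral ?J U \<le> A + B - X + \<epsilon> * C" if \<epsilon>: "\<epsilon> > 0" for \<epsilon>
  proof -
    have "\<exists>s s'. (\<forall>x\<in>?J. (s has_real_derivative s' x) (at x)) \<and> continuous_on ?J s' \<and>
        \<Lambda> * integral ?J U \<le> integral ?J (\<lambda>x. U x * (s' x + 2 * p x * s x - (s x)\<^sup>2)) + \<epsilon> * C"
      unfolding C_def by (rule two_point_inequality[OF d(1) mono odd dS cS' S'0 sep ode \<Lambda> c cU U0 \<epsilon>])
    then obtain s s' where ds0: "\<forall>x\<in>?J. (s has_real_derivative s' x) (at x)"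
      and cs': "continuous_on ?J s'"
      and ineq: "\<Lambda> * integral ?J U \<le> integral ?J (\<lambda>x. U x * (s' x + 2 * p x * s x - (s x)\<^sup>2)) + \<epsilon> * C"
      by blast
    have ds: "(s has_real_derivative s' x) (at x)" if "x \<in> ?J" for x using ds0 that by blast
    have cs: "continuous_on ?J s" using ds by (meson DERIV_isCont continuous_at_imp_continuous_on)
    have "((\<lambda>x. s' x * U x + U' x * s x) has_integral s c * U c - s (- c) * U (- c)) ?J"
    proof (rule fundamental_theorem_of_calculus)
      fix x assume "x \<in> ?J"
      from DERIV_mult[OF ds[OF this] dU[of x]]
      show "((\<lambda>x. s x * U x) has_vector_derivative s' x * U x + U' x * s x) (at x within ?J)"
        unfolding has_real_derivative_iff_has_vector_derivative[symmetric]
        by (rule has_field_derivative_at_within)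
    qed (use c in simp)
    then have parts: "((\<lambda>x. s' x * U x + U' x * s x) has_integral 0) ?J" using c by (simp add: Uz)
    have i1: "(\<lambda>x. (deriv \<phi> x)\<^sup>2) integrable_on ?J" by (intro integrable_continuous_real continuous_intros c\<phi>')
    have i2: "(\<lambda>x. (p x)\<^sup>2 * U x) integrable_on ?J"
      using pcJ(2)[OF cU] by (rule set_borel_integral_eq_integral)
    have i3: "(\<lambda>x. p x * U' x) integrable_on ?J"
      using pcJ(1)[OF cU'] by (rule set_borel_integral_eq_integral)
    have "((\<lambda>x. (deriv \<phi> x)\<^sup>2 + (p x)\<^sup>2 * U x - p x * U' x + (s' x * U x + U' x * s x)) has_integral A + B - X + 0) ?J"
      unfolding A_def B_def X_def
      by (intro has_integral_add has_integral_diff integrable_integral i1 i2 i3 parts)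
    then have rhs: "integral ?J (\<lambda>x. (deriv \<phi> x)\<^sup>2 + (p x)\<^sup>2 * U x - p x * U' x + (s' x * U x + U' x * s x)) = A + B - X"
      and rhsi: "(\<lambda>x. (deriv \<phi> x)\<^sup>2 + (p x)\<^sup>2 * U x - p x * U' x + (s' x * U x + U' x * s x)) integrable_on ?J"
      by (auto simp: has_integral_iff)
    have "integral ?J (\<lambda>x. U x * (s' x + 2 * p x * s x - (s x)\<^sup>2)) \<le> A + B - X"
      unfolding rhs[symmetric]
    proof (rule integral_le[OF _ rhsi])
      have "(\<lambda>x. p x * (2 * U x * s x)) integrable_on ?J"
        by (intro io mono_on_mult_absolutely_integrable pJ absolutely_integrable_continuous_real continuous_intros cU cs)
      moreover have "(\<lambda>x. U x * (s' x - (s x)\<^sup>2)) integrable_on ?J"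
        by (intro integrable_continuous_real continuous_intros cU cs cs')
      ultimately have "(\<lambda>x. p x * (2 * U x * s x) + U x * (s' x - (s x)\<^sup>2)) integrable_on ?J"
        by (rule integrable_add)
      moreover have "p x * (2 * U x * s x) + U x * (s' x - (s x)\<^sup>2) = U x * (s' x + 2 * p x * s x - (s x)\<^sup>2)" for x
        by (simp add: algebra_simps)
      ultimately show "(\<lambda>x. U x * (s' x + 2 * p x * s x - (s x)\<^sup>2)) integrable_on ?J" by simp
      fix x
      have "0 \<le> (deriv \<phi> x - p x * soft \<delta> (\<phi> x) + s x * soft \<delta> (\<phi> x))\<^sup>2" by simp
      then show "U x * (s' x + 2 * p x * s x - (s x)\<^sup>2) \<le>
         (deriv \<phi> x)\<^sup>2 + (p x)\<^sup>2 * U x - p x * U' x + (s' x * U x + U' x * s x)"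
        unfolding U_def U'_def power2_eq_square by (simp add: algebra_simps)
    qed
    with ineq show ?thesis by linarith
  qed
  note bound = this
  have "\<Lambda> * integral ?J U \<le> A + B - X"
  proof (rule tendsto_lowerbound)
    show "((\<lambda>\<epsilon>. A + B - X + \<epsilon> * C) \<longlongrightarrow> A + B - X) (at_right 0)"
      by (rule tendsto_eq_intros refl | simp)+
    show "eventually (\<lambda>\<epsilon>. \<Lambda> * integral ?J U \<le> A + B - X + \<epsilon> * C) (at_right 0)"
      using eventually_at_right_less[of 0] by eventually_elim (rule bound)
  qed simp
  moreover have "(LINT x:Iv d|lborel. U x) = integral ?J U" by (intro toJ cJ cU) (simp add: Uz)
  moreover have "(LINT x:Iv d|lborel. (deriv \<phi> x)\<^sup>2) = A"
    unfolding A_def by (intro toJ cJ continuous_intros c\<phi>') (simp add: \<phi>'z)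
  moreover have "(LINT x:Iv d|lborel. (p x)\<^sup>2 * U x) = B"
    unfolding B_def by (intro toJ pcJ cU) (simp add: Uz)
  ultimately show "\<Lambda> * (LINT x:Iv d|lborel. (soft \<delta> (\<phi> x))\<^sup>2) \<le>
        (LINT x:Iv d|lborel. (deriv \<phi> x)\<^sup>2) + (LINT x|\<mu>. (soft \<delta> (\<phi> x))\<^sup>2)
        + (LINT x:Iv d|lborel. (real_of_ereal (\<psi> x))\<^sup>2 * (soft \<delta> (\<phi> x))\<^sup>2)"
    using mu by (simp add: U_def X_def p_def)
qed

section \<open>Perturbations of the model potential\<close>

lemma DERIV_tan_sq: "cos t \<noteq> 0 \<Longrightarrow> (tan has_real_derivative 1 + (tan t)\<^sup>2) (at t)" for t :: real
  using DERIV_tan[of t] tan_sec[of t] by (simp add: power_inverse)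

lemma tan_ge_self: "x \<le> tan x" if "0 \<le> x" "x < pi / 2" for x :: real
proof -
  have "tan 0 - 0 \<le> tan x - x"
    using that(1)
  proof (rule DERIV_nonneg_imp_nondecreasing)
    fix z assume "0 \<le> z" "z \<le> x"
    then have "cos z \<noteq> 0" using that cos_gt_zero_pi[of z] by auto
    then have "((\<lambda>x. tan x - x) has_real_derivative (1 + (tan z)\<^sup>2) - 1) (at z)"
      by (intro DERIV_diff DERIV_tan_sq DERIV_ident)
    then show "\<exists>D. ((\<lambda>x. tan x - x) has_real_derivative D) (at z) \<and> 0 \<le> D" by fastforce
  qed
  then show ?thesis by simp
qed

lemma class_A_real:
  assumes A: "\<psi> \<in> class_A" and dom: "fin_dom \<psi> = Iv d" and xy: "x \<in> Iv d" "y \<in> Iv d" "x < y"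
  shows "2 * tan ((y - x) / 2) \<le> real_of_ereal (\<psi> y) - real_of_ereal (\<psi> x)"
    and "real_of_ereal (\<psi> x) \<le> real_of_ereal (\<psi> y)"
proof -
  have fin: "\<psi> x = ereal (real_of_ereal (\<psi> x))" "\<psi> y = ereal (real_of_ereal (\<psi> y))"
    and I: "x \<in> Iv pi" "y \<in> Iv pi"
    using xy unfolding dom[symmetric] fin_dom_def by (auto simp: ereal_real)
  have "\<psi> y - \<psi> x \<ge> ereal (2 * tan ((y - x) / 2))"
    using A xy dom by (auto simp: class_A_def)
  then show "2 * tan ((y - x) / 2) \<le> real_of_ereal (\<psi> y) - real_of_ereal (\<psi> x)"
    by (subst (asm) fin(1), subst (asm) fin(2)) simp
  have "\<psi> x \<le> \<psi> y" using A I xy(3) by (auto simp: class_A_def intro: mono_onD)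
  then show "real_of_ereal (\<psi> x) \<le> real_of_ereal (\<psi> y)"
    by (subst (asm) fin(1), subst (asm) fin(2)) simp
qed

lemma cos_pos_Iv: "d \<le> pi \<Longrightarrow> t \<in> Iv d \<Longrightarrow> 0 < cos t"
  by (rule cos_gt_zero_pi) (auto simp: Iv_def)

text \<open>
  In the model case \<open>p = tan\<close> the eigenfunction is \<open>cos\<^sup>2\<close>, and \<open>S = 3 * tan\<close> solves
  \<open>S' + 2 * S * tan - S\<^sup>2 = 3\<close>. For a perturbation \<open>S = 3 * tan + r\<close>, the left-hand side becomes
  \<open>3 + r' - 4 * r * tan - r\<^sup>2\<close>; the term with \<open>H\<close> is the contribution of any excess of the
  modulus of \<open>p\<close> over \<open>2 * tan\<close>.
\<close>
lemma lambda1_ge_of_correction: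
  fixes \<psi> :: "real \<Rightarrow> ereal" and r r' H :: "real \<Rightarrow> real"
  defines "p \<equiv> \<lambda>x. real_of_ereal (\<psi> x)"
  assumes d: "0 < d" "d \<le> pi" and A: "\<psi> \<in> class_A" and dom: "fin_dom \<psi> = Iv d" and pot: "is_potential \<psi> q"
    and sep: "\<And>x y. x \<in> Iv d \<Longrightarrow> y \<in> Iv d \<Longrightarrow> x < y \<Longrightarrow>
       2 * tan ((y - x) / 2) + H ((y - x) / 2) \<le> p y - p x"
    and odd: "\<And>t. r (- t) = - r t"
    and dr: "\<And>t. t \<in> Iv d \<Longrightarrow> (r has_real_derivative r' t) (at t)"
    and cr': "continuous_on (Iv d) r'" and r'0: "\<And>t. t \<in> Iv d \<Longrightarrow> 0 \<le> r' t"
    and ode: "\<And>t. 0 \<le> t \<Longrightarrow> t < d / 2 \<Longrightarrow>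
       \<Delta> \<le> r' t - 4 * r t * tan t - (r t)\<^sup>2 + (3 * tan t + r t) * H t"
    and \<Delta>: "0 \<le> \<Delta>"
  shows "lambda1 (Iv d) q \<ge> ereal (3 + \<Delta>)"
proof (rule lambda1_ge_of_modulus[OF d dom pot, where S = "\<lambda>t. 3 * tan t + r t" and
      S' = "\<lambda>t. 3 * (1 + (tan t)\<^sup>2) + r' t" and G = "\<lambda>t. 2 * tan t + H t"])
  have cos: "cos t \<noteq> 0" if "t \<in> Iv d" for t using cos_pos_Iv[OF d(2) that] by simp
  show "mono_on (Iv d) (\<lambda>x. real_of_ereal (\<psi> x))"
    using class_A_real(2)[OF A dom] by (intro mono_onI) (metis order_le_less order_refl)
  show "3 * tan (- t) + r (- t) = - (3 * tan t + r t)" for t by (simp add: odd)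
  show "((\<lambda>t. 3 * tan t + r t) has_real_derivative 3 * (1 + (tan t)\<^sup>2) + r' t) (at t)" if "t \<in> Iv d" for t
    by (intro DERIV_add DERIV_cmult DERIV_tan_sq cos dr that)
  show "continuous_on (Iv d) (\<lambda>t. 3 * (1 + (tan t)\<^sup>2) + r' t)"
    using cos by (intro continuous_intros cr') auto
  show "0 \<le> 3 * (1 + (tan t)\<^sup>2) + r' t" if "t \<in> Iv d" for t using r'0[OF that] by simp
  show "2 * tan ((y - x) / 2) + H ((y - x) / 2) \<le> real_of_ereal (\<psi> y) - real_of_ereal (\<psi> x)"
    if "x \<in> Iv d" "y \<in> Iv d" "x < y" for x y using sep[OF that] by (simp add: p_def)
  show "3 + \<Delta> \<le> 3 * (1 + (tan t)\<^sup>2) + r' t + (3 * tan t + r t) * (2 * tan t + H t) - (3 * tan t + r t)\<^sup>2"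
    if "0 \<le> t" "t < d / 2" for t
    using ode[OF that] by (simp add: power2_eq_square algebra_simps)
  show "0 \<le> 3 + \<Delta>" using \<Delta> by simp
qed

text \<open>
  On a domain that stops at distance \<open>e = (\<pi> - d) / 2\<close> from \<open>\<pi> / 2\<close>, the correction \<open>r\<close> is only
  required to exist up to \<open>\<pi> / 2 - e\<close>, and it may be close to blowing up there. The ansatz \<open>r = u / cos\<^sup>4\<close>, where \<open>1 / cos\<^sup>4\<close>
  solves \<open>r' = 4 * r * tan\<close>, turns the condition into
  \<open>u' / cos\<^sup>4 - u\<^sup>2 / cos\<^sup>8 \<ge> \<Delta>\<close>. As long as \<open>u \<le> e\<^sup>3 / 6\<close>, it
  suffices that \<open>u' = e\<^sup>3 / 100 + e\<^sup>6 / (36 * cos\<^sup>4)\<close>, which is integrated explicitly. The bound on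
  \<open>u\<close> is then consistent since \<open>tan \<le> 1 / e\<close> on the domain: the primitive of \<open>1 / cos\<^sup>4\<close> is of order
  \<open>1 / e\<^sup>3\<close>, and this balance dictates the third power.
\<close>
lemma lambda1_ge_of_small_domain:
  assumes d: "0 < d" "d \<le> pi" and A: "\<psi> \<in> class_A" and dom: "fin_dom \<psi> = Iv d" and pot: "is_potential \<psi> q"
  shows "lambda1 (Iv d) q \<ge> ereal (3 + 1 / 800 * (pi - d) ^ 3)"
proof -
  define e where "e = (pi - d) / 2"
  have e: "0 \<le> e" "e < pi / 2" using d by (auto simp: e_def)
  define E where "E = e ^ 3"
  have E: "E \<ge> 0" using e by (simp add: E_def)
  define u where "u t = E / 100 * t + E\<^sup>2 / 36 * (tan t + (tan t) ^ 3 / 3)" for t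
  define u' where "u' t = E / 100 + E\<^sup>2 / 36 / cos t ^ 4" for t
  have cos: "cos t > 0" if "t \<in> Iv d" for t using cos_pos_Iv[OF d(2) that] .
  have sec: "1 + (tan t)\<^sup>2 = 1 / (cos t)\<^sup>2" if "t \<in> Iv d" for t
    using tan_sec[of t] cos[OF that] by (simp add: field_simps)
  have du: "(u has_real_derivative u' t) (at t)" if "t \<in> Iv d" for t
  proof -
    have dt: "(tan has_real_derivative 1 + (tan t)\<^sup>2) (at t)"
      using cos[OF that] by (intro DERIV_tan_sq) simp
    have "(u has_real_derivative E / 100 + E\<^sup>2 / 36 * ((1 + (tan t)\<^sup>2) * (1 + (tan t)\<^sup>2))) (at t)"
      unfolding u_def
      by (rule derivative_eq_intros dt refl | simp)+ (simp add: algebra_simps power2_eq_square)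
    moreover have "(1 + (tan t)\<^sup>2) * (1 + (tan t)\<^sup>2) = 1 / cos t ^ 4"
      unfolding sec[OF that] by (simp add: power2_eq_square power4_eq_xxxx)
    ultimately show ?thesis by (simp add: u'_def)
  qed
  have tt: "0 \<le> t * tan t" if "t \<in> Iv d" for t
  proof (cases "t \<ge> 0")
    case True
    then have "tan t \<ge> 0" using that d by (intro tan_pos_pi2_le) (auto simp: Iv_def)
    then show ?thesis using True by simp
  next
    case False
    then have "tan (- t) \<ge> 0" using that d by (intro tan_pos_pi2_le) (auto simp: Iv_def)
    then show ?thesis using False by (intro mult_nonpos_nonpos) auto
  qed
  have ut: "0 \<le> u t * tan t" if "t \<in> Iv d" for t
  proof -
    have "u t * tan t = E / 100 * (t * tan t) + E\<^sup>2 / 36 * ((tan t)\<^sup>2 + ((tan t)\<^sup>2)\<^sup>2 / 3)"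
      by (simp add: u_def algebra_simps power2_eq_square power3_eq_cube)
    also have "\<dots> \<ge> 0" using E
      by (intro add_nonneg_nonneg mult_nonneg_nonneg[OF _ tt[OF that]] mult_nonneg_nonneg[of "E\<^sup>2 / 36"]) auto
    finally show ?thesis .
  qed
  have ub: "0 \<le> u t \<and> u t \<le> E / 6" if t: "0 \<le> t" "t < d / 2" for t
  proof (cases "e = 0")
    case True
    then show ?thesis by (simp add: u_def E_def)
  next
    case False
    then have e0: "e > 0" using e by simp
    have te: "t \<le> pi / 2 - e" using t by (simp add: e_def field_simps)
    have T0: "0 \<le> tan t" using t d by (intro tan_pos_pi2_le) auto
    have "tan t \<le> tan (pi / 2 - e)" using t te e0 by (intro tan_mono_le) auto
    also have "\<dots> = inverse (tan e)" by (rule tan_cot)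
    also have "\<dots> \<le> inverse e" using e0 e by (intro le_imp_inverse_le tan_ge_self) auto
    finally have T: "tan t \<le> 1 / e" by (simp add: inverse_eq_divide)
    have T3: "(tan t) ^ 3 \<le> (1 / e) ^ 3" using T T0 by (rule power_mono)
    have "E\<^sup>2 * (tan t + (tan t) ^ 3 / 3) \<le> E\<^sup>2 * (1 / e + (1 / e) ^ 3 / 3)"
      using T T3 by (intro mult_left_mono) auto
    also have "\<dots> = E * (e\<^sup>2 + 1 / 3)"
      using e0 by (simp add: E_def field_simps power2_eq_square power3_eq_cube)
    also have "\<dots> \<le> E * (4 + 1 / 3)"
    proof -
      have "e < 2" using e pi_less_4 by linarith
      then have "e\<^sup>2 \<le> 2\<^sup>2" using e by (intro power_mono) auto
      then show ?thesis using E by (intro mult_left_mono) auto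
    qed
    finally have 1: "E\<^sup>2 * (tan t + (tan t) ^ 3 / 3) \<le> E * (4 + 1 / 3)" .
    have "t \<le> 2" using te e0 pi_less_4 by linarith
    then have 2: "E * t \<le> E * 2" using E by (rule mult_left_mono)
    have "u t \<le> E / 6" using 1 2 E unfolding u_def by (simp add: field_simps)
    moreover have "u t \<ge> 0" unfolding u_def using E t T0 by (intro add_nonneg_nonneg mult_nonneg_nonneg) auto
    ultimately show ?thesis by simp
  qed
  have "lambda1 (Iv d) q \<ge> ereal (3 + E / 100)"
  proof (rule lambda1_ge_of_correction[OF d A dom pot, where r = "\<lambda>t. u t / cos t ^ 4" and H = "\<lambda>_. 0"
        and r' = "\<lambda>t. u' t / cos t ^ 4 + 4 * (u t * tan t) / cos t ^ 4"])
    show "2 * tan ((y - x) / 2) + 0 \<le> real_of_ereal (\<psi> y) - real_of_ereal (\<psi> x)"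
      if "x \<in> Iv d" "y \<in> Iv d" "x < y" for x y using class_A_real(1)[OF A dom that] by simp
    have "u (- t) = - u t" for t by (simp add: u_def field_simps power3_eq_cube)
    then show "u (- t) / cos (- t) ^ 4 = - (u t / cos t ^ 4)" for t by simp
    show "((\<lambda>t. u t / cos t ^ 4) has_real_derivative u' t / cos t ^ 4 + 4 * (u t * tan t) / cos t ^ 4) (at t)"
      if "t \<in> Iv d" for t
    proof -
      have c: "cos t \<noteq> 0" using cos[OF that] by simp
      show ?thesis
        by (rule derivative_eq_intros du that refl | simp add: c)+
          (simp add: c tan_def field_simps eval_nat_numeral)
    qed
    have cu: "continuous_on (Iv d) u" using du by (meson DERIV_isCont continuous_at_imp_continuous_on)
    show "continuous_on (Iv d) (\<lambda>t. u' t / cos t ^ 4 + 4 * (u t * tan t) / cos t ^ 4)"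
      unfolding u'_def using cos by (intro continuous_intros cu) (auto simp: less_imp_neq[symmetric])
    show "0 \<le> u' t / cos t ^ 4 + 4 * (u t * tan t) / cos t ^ 4" if "t \<in> Iv d" for t
      using cos[OF that] E unfolding u'_def
      by (intro add_nonneg_nonneg divide_nonneg_pos mult_nonneg_nonneg[OF _ ut[OF that]]) auto
    show "E / 100 \<le> u' t / cos t ^ 4 + 4 * (u t * tan t) / cos t ^ 4 - 4 * (u t / cos t ^ 4) * tan t
        - (u t / cos t ^ 4)\<^sup>2 + (3 * tan t + u t / cos t ^ 4) * 0" if t: "0 \<le> t" "t < d / 2" for t
    proof -
      have c: "0 < cos t" using t d by (intro cos) (auto simp: Iv_def)
      define k where "k = 1 / cos t ^ 4"
      have "cos t ^ 4 \<le> 1" using c by (intro power_le_one) auto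
      then have k: "1 \<le> k" using c by (simp add: k_def)
      have "(u t)\<^sup>2 \<le> (E / 6)\<^sup>2" using ub[OF t] by (intro power_mono) auto
      then have "(u t)\<^sup>2 * k\<^sup>2 \<le> (E / 6)\<^sup>2 * k\<^sup>2" by (rule mult_right_mono) simp
      moreover have "E / 100 * 1 \<le> E / 100 * k" using k E by (intro mult_left_mono) auto
      moreover have "(u t * k)\<^sup>2 = (u t)\<^sup>2 * k\<^sup>2" "E\<^sup>2 / 36 * k * k = (E / 6)\<^sup>2 * k\<^sup>2"
        by (simp_all add: power2_eq_square)
      ultimately have "E / 100 \<le> E / 100 * k + E\<^sup>2 / 36 * k * k - (u t * k)\<^sup>2" by linarith
      moreover have "u' t / cos t ^ 4 = E / 100 * k + E\<^sup>2 / 36 * k * k"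
      proof -
        have "u' t = E / 100 + E\<^sup>2 / 36 * k" by (simp add: u'_def k_def)
        moreover have "u' t / cos t ^ 4 = u' t * k" by (simp add: k_def)
        ultimately show ?thesis by (simp only: distrib_right)
      qed
      moreover have "u t / cos t ^ 4 = u t * k" "4 * (u t * tan t) / cos t ^ 4 = 4 * (u t * k) * tan t"
        by (simp_all add: k_def)
      ultimately show ?thesis by simp
    qed
  qed (use E in auto)
  moreover have "E / 100 = 1 / 800 * (pi - d) ^ 3" by (simp add: E_def e_def power_divide)
  ultimately show ?thesis by simp
qed

section \<open>Gain from an affine piece of the weight\<close>

text \<open>
  Each tangent lies above the graph; adding the two tangent inequalities at \<open>x\<close> and \<open>y\<close> gives the claim.
\<close>
lemma concave_on_deriv_antimono:
  fixes L :: "real \<Rightarrow> real"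
  assumes L: "concave_on A L" "open A" "connected A" and xy: "x \<in> A" "y \<in> A" "x \<le> y"
    and dx: "(L has_real_derivative l) (at x)" and dy: "(L has_real_derivative l') (at y)"
  shows "l' \<le> l"
proof (cases "x = y")
  case True
  then show ?thesis using DERIV_unique[OF dx] dy by auto
next
  case False
  have c: "convex_on A (\<lambda>x. - L x)" using L(1) by (simp add: concave_on_def)
  have "- L y - - L x \<ge> - l * (y - x)"
    using L xy DERIV_minus[OF dx]
    by (intro convex_on_imp_above_tangent[OF c L(3)]) (auto simp: interior_open intro: has_field_derivative_at_within)
  moreover have "- L x - - L y \<ge> - l' * (x - y)"
    using L xy DERIV_minus[OF dy]
    by (intro convex_on_imp_above_tangent[OF c L(3)]) (auto simp: interior_open intro: has_field_derivative_at_within)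
  ultimately have "0 \<le> (l - l') * (y - x)" by (simp add: algebra_simps)
  then show ?thesis using False xy(3) by (simp add: zero_le_mult_iff)
qed

text \<open>
  \<open>ln \<circ> h\<close> is \<open>m\<close> times the logarithm of the concave root of \<open>h\<close>, and \<open>ln\<close> is concave and increasing.
\<close>
lemma concave_on_ln_of_root_concave:
  fixes h :: "real \<Rightarrow> real"
  assumes h: "\<And>x. x \<in> A \<Longrightarrow> 0 < h x" and c: "concave_on A (\<lambda>x. h x powr (1 / real m))" and m: "m \<noteq> 0"
  shows "concave_on A (\<lambda>x. ln (h x))"
  unfolding concave_on_iff
proof (intro conjI ballI allI impI)
  show cA: "convex A" using c by (simp add: concave_on_iff)
  fix x y and u v :: real assume xy: "x \<in> A" "y \<in> A" and uv: "0 \<le> u" "0 \<le> v" "u + v = 1"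
  let ?k = "\<lambda>x. h x powr (1 / real m)" and ?z = "u *\<^sub>R x + v *\<^sub>R y"
  have z: "?z \<in> A" using convexD[OF cA xy uv] .
  have kp: "?k x > 0" "?k y > 0" using h xy by (auto simp: less_le)
  have lnk: "ln (?k w) = ln (h w) / m" if "w \<in> A" for w using h[OF that] by (simp add: ln_powr)
  have "u * ln (?k x) + v * ln (?k y) \<le> ln (u * ?k x + v * ?k y)"
  proof -
    have "?k x \<in> {0<..}" "?k y \<in> {0<..}" "v \<le> 1" using kp uv by simp_all
    moreover have "u = 1 - v" using uv by simp
    ultimately show ?thesis
      using concave_onD[OF ln_concave uv(2), of "?k x" "?k y"] by (simp only: real_scaleR_def)
  qed
  also have "\<dots> \<le> ln (?k ?z)"
  proof (rule ln_mono)
    show "u * ?k x + v * ?k y \<le> ?k ?z" using c xy uv unfolding concave_on_iff by blast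
    show "0 < u * ?k x + v * ?k y"
    proof (cases "u = 0")
      case True
      then show ?thesis using kp(2) uv(3) by simp
    next
      case False
      then have "0 < u * ?k x" using uv(1) kp(1) by (intro mult_pos_pos) auto
      moreover have "0 \<le> v * ?k y" using uv(2) by simp
      ultimately show ?thesis by (rule add_pos_nonneg)
    qed
  qed
  finally have "(u * ln (h x) + v * ln (h y)) / m \<le> ln (h ?z) / m"
    unfolding lnk[OF xy(1)] lnk[OF xy(2)] lnk[OF z] by (simp add: add_divide_distrib)
  then show "u * ln (h x) + v * ln (h y) \<le> ln (h ?z)" using m by (simp add: divide_le_cancel)
qed

lemma AE_lborel_between:
  assumes "AE x in lborel. P x" "u < (v::real)"
  obtains x where "u < x" "x < v" "P x"
proof -
  obtain N where N: "N \<in> null_sets lborel" "{x. \<not> P x} \<subseteq> N"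
    using assms(1) by (auto simp: eventually_ae_filter)
  have "\<not> {u<..<v} \<subseteq> N"
  proof
    assume "{u<..<v} \<subseteq> N"
    then have "emeasure lborel {u<..<v} \<le> emeasure lborel N" using N by (intro emeasure_mono) auto
    then show False using N assms(2) by (simp add: null_sets_def ennreal_eq_0_iff)
  qed
  then obtain x where "x \<in> {u<..<v}" "x \<notin> N" by blast
  then show ?thesis using N(2) by (intro that[of x]) auto
qed

text \<open>
  The function \<open>g = - (ln h)'\<close> is increasing by concavity of \<open>ln h\<close>. Points of \<open>(-\<pi>/2, \<pi>/2)\<close> at
  distance more than \<open>\<pi> / 2\<close> always enclose \<open>[-\<pi>/16, 0]\<close> or \<open>[0, \<pi>/16]\<close>, where
  \<open>h\<close> is affine and \<open>g = - \<alpha> / h\<close> has derivative \<open>g\<^sup>2\<close>. Finally \<open>\<bar>\<alpha>\<bar> * (b - a)\<close> is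
  the distance of \<open>h b\<close> and \<open>h a\<close>, which compares the slope with the ratio of the two values.
\<close>
lemma log_derivative_gap:
  fixes g h :: "real \<Rightarrow> real"
  assumes d: "d \<le> pi" and hpos: "\<And>x. x \<in> Iv d \<Longrightarrow> 0 < h x"
    and conc: "concave_on (Iv d) (\<lambda>x. ln (h x))"
    and aff: "\<And>x. x \<in> {a..b} \<Longrightarrow> h x = \<alpha> * x + \<beta>"
    and sub: "Iv (pi / 4) \<subseteq> {a..b}" "{a..b} \<subseteq> Iv d"
    and xy: "x \<in> Iv d" "y \<in> Iv d" "pi / 2 < y - x"
    and dx: "((\<lambda>t. ln (h t)) has_real_derivative - g x) (at x)"
    and dy: "((\<lambda>t. ln (h t)) has_real_derivative - g y) (at y)"
  shows "(1 - min (h a) (h b) / max (h a) (h b))\<^sup>2 / (16 * pi) \<le> g y - g x"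
proof -
  have xI: "- (pi / 2) < x" "x < pi / 2" "- (pi / 2) < y" "y < pi / 2" using xy d by (auto simp: Iv_def)
  have mid: "0 \<in> Iv (pi / 4)" "- (pi / 16) \<in> Iv (pi / 4)" "pi / 16 \<in> Iv (pi / 4)"
    using pi_gt_zero unfolding Iv_def greaterThanLessThan_iff by argo+
  obtain P Q where PQ: "P \<in> Iv (pi / 4)" "Q \<in> Iv (pi / 4)" "Q - P = pi / 16" "x \<le> P" "Q \<le> y"
  proof (cases "x \<le> - (pi / 16)")
    case True
    then show ?thesis using xI xy mid by (intro that[of "- (pi / 16)" 0]) auto
  next
    case False
    then show ?thesis using xI xy mid by (intro that[of 0 "pi / 16"]) auto
  qed
  define M where "M = max (h a) (h b)"
  have ab: "a \<le> 0" "0 \<le> b" using mid(1) sub(1) by auto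
  have abI: "a \<in> {a..b}" "b \<in> {a..b}" using ab by auto
  have M: "M > 0" using hpos[of a] abI sub(2) by (auto simp: M_def less_max_iff_disj)
  have hM: "0 < h z \<and> h z \<le> M" if z: "z \<in> {a..b}" for z
  proof -
    have "h z \<le> M"
    proof (cases "\<alpha> \<ge> 0")
      case True
      then have "\<alpha> * z \<le> \<alpha> * b" using z by (intro mult_left_mono) auto
      then show ?thesis using aff[OF z] aff[OF abI(2)] by (simp add: M_def)
    next
      case False
      then have "\<alpha> * z \<le> \<alpha> * a" using z by (intro mult_left_mono_neg) auto
      then show ?thesis using aff[OF z] aff[OF abI(1)] by (simp add: M_def)
    qed
    then show ?thesis using hpos z sub(2) by auto
  qed
  have dL: "((\<lambda>t. ln (h t)) has_real_derivative \<alpha> / h z) (at z)" if z: "z \<in> Iv (pi / 4)" for z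
  proof -
    have hz: "h z > 0" using z sub hM by blast
    have "((\<lambda>t. \<alpha> * t + \<beta>) has_real_derivative \<alpha>) (at z)" by (auto intro!: derivative_eq_intros)
    moreover have "eventually (\<lambda>t. t \<in> Iv (pi / 4)) (nhds z)"
      using z by (intro eventually_nhds_in_open) (auto simp: Iv_def)
    then have "eventually (\<lambda>t. \<alpha> * t + \<beta> = h t) (nhds z)"
      by eventually_elim (use aff sub(1) in auto)
    ultimately have dh: "(h has_real_derivative \<alpha>) (at z)" by (simp add: DERIV_cong_ev)
    from DERIV_chain2[OF DERIV_ln[OF hz] this] show ?thesis by (simp add: divide_inverse mult.commute)
  qed
  have PQd: "P \<in> {a..b}" "Q \<in> {a..b}" "P \<in> Iv d" "Q \<in> Iv d" using PQ sub by blast+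
  have opc: "open (Iv d)" "connected (Iv d)" by (simp_all add: Iv_def)
  have "\<alpha> / h P \<le> - g x"
    by (rule concave_on_deriv_antimono[OF conc opc xy(1) PQd(3) PQ(4) dx dL[OF PQ(1)]])
  moreover have "- g y \<le> \<alpha> / h Q"
    by (rule concave_on_deriv_antimono[OF conc opc PQd(4) xy(2) PQ(5) dL[OF PQ(2)] dy])
  ultimately have "\<alpha> / h P - \<alpha> / h Q \<le> g y - g x" by linarith
  moreover have "\<alpha> / h P - \<alpha> / h Q = \<alpha>\<^sup>2 * (pi / 16) / (h P * h Q)"
  proof -
    have hQP: "h Q - h P = \<alpha> * (pi / 16)"
      unfolding PQ(3)[symmetric] aff[OF PQd(1)] aff[OF PQd(2)] by (simp add: algebra_simps)
    have "\<alpha> / h P - \<alpha> / h Q = \<alpha> * (h Q - h P) / (h P * h Q)"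
      using hM[OF PQd(1)] hM[OF PQd(2)] by (simp add: field_simps)
    then show ?thesis unfolding hQP by (simp add: power2_eq_square)
  qed
  moreover have "\<alpha>\<^sup>2 * (pi / 16) / (M * M) \<le> \<alpha>\<^sup>2 * (pi / 16) / (h P * h Q)"
    using hM[OF PQd(1)] hM[OF PQd(2)] M by (intro divide_left_mono mult_mono mult_pos_pos) auto
  moreover have "(1 - min (h a) (h b) / M)\<^sup>2 / (16 * pi) \<le> \<alpha>\<^sup>2 * (pi / 16) / (M * M)"
  proof -
    have "1 - min (h a) (h b) / M = \<bar>h b - h a\<bar> / M"
      using M by (auto simp: M_def field_simps min_def max_def)
    also have "h b - h a = \<alpha> * (b - a)"
      unfolding aff[OF abI(1)] aff[OF abI(2)] by (simp add: algebra_simps)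
    finally have "(1 - min (h a) (h b) / M)\<^sup>2 = \<alpha>\<^sup>2 * (b - a)\<^sup>2 / (M * M)"
      by (simp add: power_divide power_mult_distrib power2_eq_square)
    also have "\<dots> \<le> \<alpha>\<^sup>2 * pi\<^sup>2 / (M * M)"
    proof -
      have "a \<in> Iv d" "b \<in> Iv d" using abI sub(2) by auto
      then have "b - a \<le> pi" using d by (auto simp: Iv_def)
      then have "(b - a)\<^sup>2 \<le> pi\<^sup>2" using ab by (intro power_mono) auto
      then show ?thesis by (intro divide_right_mono mult_left_mono) auto
    qed
    finally have "(1 - min (h a) (h b) / M)\<^sup>2 / (16 * pi) \<le> \<alpha>\<^sup>2 * pi\<^sup>2 / (M * M) / (16 * pi)"
      by (intro divide_right_mono) auto
    also have "\<dots> = \<alpha>\<^sup>2 * (pi / 16) / (M * M)" by (simp add: power2_eq_square)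
    finally show ?thesis .
  qed
  ultimately show ?thesis unfolding M_def by linarith
qed

text \<open>
  Pairs at half-distance \<open>t > \<pi> / 4\<close> have a surplus \<open>\<beta>\<close> in the modulus, worth \<open>3 * \<beta> * tan t\<close> in the
  differential inequality; closer pairs have none. The correction \<open>r\<close> spreads the surplus. It
  increases on \<open>[0, \<pi>/4]\<close>, where \<open>r = sinh (4 * t)\<close> works because \<open>tan \<le> 1\<close> there:
  \<open>r' - 4 * r * tan \<ge> 4 * (cosh - sinh) = 4 * exp (- 4 * t)\<close>. Beyond \<open>\<pi> / 4\<close> it costs at most
  \<open>4 * r * tan + r\<^sup>2\<close>, with \<open>r\<close> bounded, which the surplus pays for once \<open>r\<close> is multiplied by a small
  constant \<open>a * \<beta>\<close>. The value \<open>a = exp (- 5 * \<pi>)\<close> makes \<open>r \<le> \<beta> / 4\<close> on the whole domain, and the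
  square \<open>r\<^sup>2\<close> negligible on the first part.
\<close>
lemma lambda1_ge_of_jump:
  fixes \<psi> :: "real \<Rightarrow> ereal"
  defines "p \<equiv> \<lambda>x. real_of_ereal (\<psi> x)"
  assumes d: "0 < d" "d \<le> pi" and A: "\<psi> \<in> class_A" and dom: "fin_dom \<psi> = Iv d" and pot: "is_potential \<psi> q"
    and \<beta>: "0 \<le> \<beta>" "\<beta> \<le> 1"
    and sep: "\<And>x y. x \<in> Iv d \<Longrightarrow> y \<in> Iv d \<Longrightarrow> pi / 2 < y - x \<Longrightarrow>
       2 * tan ((y - x) / 2) + \<beta> \<le> p y - p x"
  shows "lambda1 (Iv d) q \<ge> ereal (3 + exp (- (6 * pi)) * \<beta>)"
proof -
  define a where "a = exp (- (5 * pi))"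
  have a: "a > 0" by (simp add: a_def)
  have ae: "a * exp (- pi) = exp (- (6 * pi))" by (simp add: a_def flip: exp_add)
  have ae2: "a * exp (2 * pi) = exp (- (3 * pi))" by (simp add: a_def flip: exp_add)
  have sinh_le: "sinh z \<le> exp z" for z :: real
  proof -
    have "2 * sinh z = exp z - exp (- z)" by (simp add: sinh_field_def)
    moreover have "0 < exp z" "0 < exp (- z)" by simp_all
    ultimately show ?thesis by linarith
  qed
  show ?thesis
  proof (rule lambda1_ge_of_correction[OF d A dom pot, where r = "\<lambda>t. a * \<beta> * sinh (4 * t)" and
        r' = "\<lambda>t. 4 * (a * \<beta>) * cosh (4 * t)" and H = "\<lambda>t. if t > pi / 4 then \<beta> else 0"])
    show "2 * tan ((y - x) / 2) + (if (y - x) / 2 > pi / 4 then \<beta> else 0) \<le> real_of_ereal (\<psi> y) - real_of_ereal (\<psi> x)"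
      if "x \<in> Iv d" "y \<in> Iv d" "x < y" for x y
      using class_A_real(1)[OF A dom that] sep[OF that(1,2)] by (auto simp: p_def)
    show "a * \<beta> * sinh (4 * - t) = - (a * \<beta> * sinh (4 * t))" for t by simp
    show "((\<lambda>t. a * \<beta> * sinh (4 * t)) has_real_derivative 4 * (a * \<beta>) * cosh (4 * t)) (at t)" for t
      by (auto intro!: derivative_eq_intros)
    show "continuous_on (Iv d) (\<lambda>t. 4 * (a * \<beta>) * cosh (4 * t))" by (intro continuous_intros)
    show "0 \<le> 4 * (a * \<beta>) * cosh (4 * t)" for t
      using a \<beta> cosh_real_nonneg[of "4 * t"] by (intro mult_nonneg_nonneg) auto
    show "0 \<le> exp (- (6 * pi)) * \<beta>" using \<beta> by simp
    fix t assume t: "0 \<le> t" "t < d / 2"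
    have t2: "t < pi / 2" using t d by simp
    have tl: "- (pi / 2) < t" "- (pi / 2) < pi / 4" using t(1) pi_gt_zero by linarith+
    have sh: "0 \<le> sinh (4 * t)" using t by simp
    show "exp (- (6 * pi)) * \<beta> \<le> 4 * (a * \<beta>) * cosh (4 * t) - 4 * (a * \<beta> * sinh (4 * t)) * tan t
        - (a * \<beta> * sinh (4 * t))\<^sup>2 + (3 * tan t + a * \<beta> * sinh (4 * t)) * (if t > pi / 4 then \<beta> else 0)"
    proof (cases "t > pi / 4")
      case False
      have "tan t \<le> tan (pi / 4)" using False tl pi_gt_zero by (intro tan_mono_le) linarith+
      then have T: "tan t \<le> 1" by (simp add: tan_45)
      have "sinh (4 * t) * tan t \<le> sinh (4 * t) * 1" using T sh by (intro mult_left_mono)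
      then have "exp (- (4 * t)) \<le> cosh (4 * t) - sinh (4 * t) * tan t"
        using cosh_minus_sinh[of "4 * t"] by simp
      moreover have "exp (- pi) \<le> exp (- (4 * t))" using False by simp
      ultimately have 1: "exp (- pi) \<le> cosh (4 * t) - sinh (4 * t) * tan t" by linarith
      have "sinh (4 * t) \<le> exp pi"
        using sinh_le[of "4 * t"] False by (intro order_trans[OF sinh_le]) simp
      then have "(sinh (4 * t))\<^sup>2 \<le> (exp pi)\<^sup>2" using sh by (intro power_mono)
      also have "(exp pi)\<^sup>2 = exp (2 * pi)" by (simp add: power2_eq_square flip: exp_add)
      finally have "a * (sinh (4 * t))\<^sup>2 \<le> a * exp (2 * pi)" using a by (intro mult_left_mono) auto
      also have "\<dots> \<le> exp (- pi)" unfolding ae2 by simp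
      finally have 2: "a * (sinh (4 * t))\<^sup>2 \<le> exp (- pi)" .
      have "(a * \<beta> * sinh (4 * t))\<^sup>2 = (a * \<beta>) * (\<beta> * (a * (sinh (4 * t))\<^sup>2))"
        by (simp add: power2_eq_square algebra_simps)
      also have "\<dots> \<le> (a * \<beta>) * (1 * exp (- pi))"
        using 2 a \<beta> by (intro mult_left_mono mult_mono) auto
      finally have 3: "(a * \<beta> * sinh (4 * t))\<^sup>2 \<le> a * \<beta> * exp (- pi)" by simp
      have "4 * (a * \<beta>) * exp (- pi) \<le> 4 * (a * \<beta>) * (cosh (4 * t) - sinh (4 * t) * tan t)"
        using 1 a \<beta> by (intro mult_left_mono) auto
      then have 4: "4 * (a * \<beta> * exp (- pi)) \<le> 4 * (a * \<beta>) * cosh (4 * t) - 4 * (a * \<beta> * sinh (4 * t)) * tan t"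
        by (simp add: algebra_simps)
      have "0 \<le> a * \<beta> * exp (- pi)" using a \<beta> by simp
      moreover have "exp (- (6 * pi)) * \<beta> = a * \<beta> * exp (- pi)" by (simp flip: ae)
      ultimately have "exp (- (6 * pi)) * \<beta> \<le> 4 * (a * \<beta>) * cosh (4 * t) - 4 * (a * \<beta> * sinh (4 * t)) * tan t
        - (a * \<beta> * sinh (4 * t))\<^sup>2"
        using 3 4 by linarith
      then show ?thesis using False by simp
    next
      case True
      have "tan (pi / 4) \<le> tan t" using True t2 tl by (intro tan_mono_le) auto
      then have T: "1 \<le> tan t" by (simp add: tan_45)
      define r where "r = a * \<beta> * sinh (4 * t)"
      have r0: "0 \<le> r" using a \<beta> sh by (simp add: r_def)
      have "r \<le> a * \<beta> * exp (2 * pi)"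
        unfolding r_def using a \<beta> t2 by (intro mult_left_mono order_trans[OF sinh_le]) auto
      also have "\<dots> = \<beta> * exp (- (3 * pi))" using ae2 by (simp add: algebra_simps)
      also have "\<dots> \<le> \<beta> * (1 / 4)"
      proof (rule mult_left_mono)
        have "4 \<le> exp (3 * pi)" using exp_ge_add_one_self[of "3 * pi"] pi_gt3 by linarith
        then show "exp (- (3 * pi)) \<le> 1 / 4" by (simp add: exp_minus field_simps)
      qed (use \<beta> in simp)
      finally have r1: "4 * r \<le> \<beta>" by simp
      have "r * r \<le> 1 * \<beta>" using r0 r1 \<beta> by (intro mult_mono) auto
      then have r2: "r\<^sup>2 \<le> \<beta>" by (simp add: power2_eq_square)
      have r3: "4 * r * tan t \<le> \<beta> * tan t" using r1 T by (intro mult_right_mono) auto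
      have r4: "\<beta> * 1 \<le> \<beta> * tan t" using T \<beta> by (intro mult_left_mono) auto
      have r5: "0 \<le> r * \<beta>" using r0 \<beta> by simp
      have r6: "0 \<le> 4 * (a * \<beta>) * cosh (4 * t)"
        using a \<beta> cosh_real_nonneg[of "4 * t"] by (intro mult_nonneg_nonneg) auto
      have "exp (- (6 * pi)) * \<beta> \<le> 1 * \<beta>" using \<beta> by (intro mult_right_mono) auto
      moreover have "\<beta> \<le> 4 * (a * \<beta>) * cosh (4 * t) - 4 * r * tan t - r\<^sup>2 + (3 * tan t + r) * \<beta>"
        using r2 r3 r4 r5 r6 by (simp add: algebra_simps)
      ultimately have "exp (- (6 * pi)) * \<beta> \<le>
          4 * (a * \<beta>) * cosh (4 * t) - 4 * r * tan t - r\<^sup>2 + (3 * tan t + r) * \<beta>"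
        by linarith
      then show ?thesis using True by (simp add: r_def)
    qed
  qed
qed

text \<open>
  The derivative of \<open>ln h\<close> is known to be \<open>- g\<close> only almost everywhere. Any two points can be moved
  slightly towards each other to good points; monotonicity of \<open>p\<close> and continuity of \<open>tan\<close>
  transfer the inequality back.
\<close>
lemma separation_of_AE:
  fixes p f g :: "real \<Rightarrow> real"
  assumes d: "d \<le> pi" and p: "mono_on (Iv d) p" "\<And>x. x \<in> Iv d \<Longrightarrow> p x = f x + g x / 2"
    and f: "\<And>x y. x \<in> Iv d \<Longrightarrow> y \<in> Iv d \<Longrightarrow> x < y \<Longrightarrow> 2 * tan ((y - x) / 2) \<le> f y - f x"
    and good: "AE x in lborel. x \<in> Iv d \<longrightarrow> good x"
    and g: "\<And>x y. x \<in> Iv d \<Longrightarrow> y \<in> Iv d \<Longrightarrow> pi / 2 < y - x \<Longrightarrow> good x \<Longrightarrow> good y \<Longrightarrow> 2 * \<beta> \<le> g y - g x"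
    and xy: "x \<in> Iv d" "y \<in> Iv d" "pi / 2 < y - x"
  shows "2 * tan ((y - x) / 2) + \<beta> \<le> p y - p x"
proof (rule ccontr)
  assume "\<not> ?thesis"
  then have lt: "(p y - p x - \<beta>) / 2 < tan ((y - x) / 2)" by simp
  have "cos ((y - x) / 2) \<noteq> 0"
    using cos_gt_zero_pi[of "(y - x) / 2"] xy d by (auto simp: Iv_def)
  then have "(tan \<longlongrightarrow> tan ((y - x) / 2)) (at ((y - x) / 2))" by (intro isCont_tan[unfolded isCont_def])
  from order_tendstoD(1)[OF this lt] obtain \<delta> where \<delta>: "\<delta> > 0"
    and near: "\<And>u. u \<noteq> (y - x) / 2 \<Longrightarrow> dist u ((y - x) / 2) < \<delta> \<Longrightarrow> (p y - p x - \<beta>) / 2 < tan u"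
    unfolding eventually_at by auto
  define \<eta> where "\<eta> = min \<delta> ((y - x - pi / 2) / 2)"
  have \<eta>: "0 < \<eta>" "\<eta> \<le> \<delta>" "2 * \<eta> \<le> y - x - pi / 2" using \<delta> xy by (auto simp: \<eta>_def min_def)
  obtain x' where x': "x < x'" "x' < x + \<eta>" "x' \<in> Iv d \<longrightarrow> good x'"
    using AE_lborel_between[OF good, of x "x + \<eta>"] \<eta> by auto
  obtain y' where y': "y - \<eta> < y'" "y' < y" "y' \<in> Iv d \<longrightarrow> good y'"
    using AE_lborel_between[OF good, of "y - \<eta>" y] \<eta> by auto
  have gap: "pi / 2 < y' - x'" using x' y' \<eta> by linarith
  have "x' < y" "x < y'" using gap x' y' pi_gt_zero by linarith+
  then have I: "x' \<in> Iv d" "y' \<in> Iv d" using x' y' xy by (auto simp: Iv_def)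
  have "dist ((y' - x') / 2) ((y - x) / 2) < \<delta>" using x'(1,2) y'(1,2) \<eta>(2) unfolding dist_real_def abs_less_iff
    by (auto simp: field_simps)
  moreover have "(y' - x') / 2 \<noteq> (y - x) / 2" using x' y' by simp
  ultimately have "(p y - p x - \<beta>) / 2 < tan ((y' - x') / 2)" by (intro near)
  moreover have "2 * tan ((y' - x') / 2) \<le> f y' - f x'" using f[OF I] gap pi_gt_zero by linarith
  moreover have "2 * \<beta> \<le> g y' - g x'" using g[OF I gap] x' y' I by blast
  moreover have "p x \<le> p x'" "p y' \<le> p y"
    using x' y' I xy by (auto intro!: mono_onD[OF p(1)])
  ultimately show False using p(2)[OF I(1)] p(2)[OF I(2)] by argo
qed

section \<open>Stability of the eigenvalue bound\<close>

theorem theorem20: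
  "(\<exists>C::real. C > 0 \<and>
     (\<forall>(d::real) \<psi> q.
        0 < d \<longrightarrow> d \<le> pi \<longrightarrow>
        \<psi> \<in> class_A \<longrightarrow> fin_dom \<psi> = Iv d \<longrightarrow> is_potential \<psi> q \<longrightarrow>
        lambda1 (Iv d) q \<ge> ereal (3 + C * (pi - d) ^ 3)))
   \<and>
   (\<exists>K::real. K > 0 \<and>
     (\<forall>(d::real) (m::nat) \<psi> q f (g::real \<Rightarrow> real) (h::real \<Rightarrow> real) (a::real) (b::real).
        0 < d \<longrightarrow> d \<le> pi \<longrightarrow> m \<noteq> 0 \<longrightarrow>
        \<psi> \<in> class_A \<longrightarrow> is_potential \<psi> q \<longrightarrow>
        f \<in> class_A \<longrightarrow> fin_dom f = Iv d \<longrightarrow>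
        (\<forall>x\<in>Iv pi. \<psi> x = f x + ereal (g x / 2)) \<longrightarrow>
        (\<forall>x\<in>Iv d. h x > 0) \<longrightarrow>
        concave_on (Iv d) (\<lambda>x. h x powr (1 / real m)) \<longrightarrow>
        (AE x in lborel. x \<in> Iv d \<longrightarrow> ((\<lambda>t. ln (h t)) has_real_derivative (- g x)) (at x)) \<longrightarrow>
        (\<exists>\<alpha> \<beta>. \<forall>x\<in>{a..b}. h x = \<alpha> * x + \<beta>) \<longrightarrow>
        Iv (pi / 4) \<subseteq> {a..b} \<longrightarrow> {a..b} \<subseteq> Iv d \<longrightarrow>
        lambda1 (Iv d) q \<le> 7 \<longrightarrow>
        lambda1 (Iv d) q \<ge>
          ereal (3 + 8 * K / (real m * pi\<^sup>2) * (1 - min (h a) (h b) / max (h a) (h b))\<^sup>2)))"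
proof (rule conjI)
  show "\<exists>C::real. C > 0 \<and>
     (\<forall>(d::real) \<psi> q.
        0 < d \<longrightarrow> d \<le> pi \<longrightarrow>
        \<psi> \<in> class_A \<longrightarrow> fin_dom \<psi> = Iv d \<longrightarrow> is_potential \<psi> q \<longrightarrow>
        lambda1 (Iv d) q \<ge> ereal (3 + C * (pi - d) ^ 3))"
    using lambda1_ge_of_small_domain by (intro exI[of _ "1 / 800"]) simp
next
  \<comment> \<open>Chosen so that \<open>8 * K / \<pi>\<^sup>2\<close> is \<open>exp (- 6 * \<pi>) / (32 * \<pi>)\<close>, the factor that the surplus argument yields.\<close>
  define K where "K = exp (- (6 * pi)) * pi / 256"
  have K: "K > 0" by (simp add: K_def)
  show "\<exists>K::real. K > 0 \<and>
     (\<forall>(d::real) (m::nat) \<psi> q f (g::real \<Rightarrow> real) (h::real \<Rightarrow> real) (a::real) (b::real).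
        0 < d \<longrightarrow> d \<le> pi \<longrightarrow> m \<noteq> 0 \<longrightarrow>
        \<psi> \<in> class_A \<longrightarrow> is_potential \<psi> q \<longrightarrow>
        f \<in> class_A \<longrightarrow> fin_dom f = Iv d \<longrightarrow>
        (\<forall>x\<in>Iv pi. \<psi> x = f x + ereal (g x / 2)) \<longrightarrow>
        (\<forall>x\<in>Iv d. h x > 0) \<longrightarrow>
        concave_on (Iv d) (\<lambda>x. h x powr (1 / real m)) \<longrightarrow>
        (AE x in lborel. x \<in> Iv d \<longrightarrow> ((\<lambda>t. ln (h t)) has_real_derivative (- g x)) (at x)) \<longrightarrow>
        (\<exists>\<alpha> \<beta>. \<forall>x\<in>{a..b}. h x = \<alpha> * x + \<beta>) \<longrightarrow>
        Iv (pi / 4) \<subseteq> {a..b} \<longrightarrow> {a..b} \<subseteq> Iv d \<longrightarrow>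
        lambda1 (Iv d) q \<le> 7 \<longrightarrow>
        lambda1 (Iv d) q \<ge>
          ereal (3 + 8 * K / (real m * pi\<^sup>2) * (1 - min (h a) (h b) / max (h a) (h b))\<^sup>2))"
  proof (intro exI[of _ K] conjI K allI impI)
    fix d :: real and m :: nat and \<psi> q f and g h :: "real \<Rightarrow> real" and a b :: real
    assume d: "0 < d" "d \<le> pi" and m: "m \<noteq> 0" and \<psi>: "\<psi> \<in> class_A" and pot: "is_potential \<psi> q"
      and f: "f \<in> class_A" and domf: "fin_dom f = Iv d"
      and \<psi>f: "\<forall>x\<in>Iv pi. \<psi> x = f x + ereal (g x / 2)"
      and hpos: "\<forall>x\<in>Iv d. h x > 0" and hc: "concave_on (Iv d) (\<lambda>x. h x powr (1 / real m))"
      and hg: "AE x in lborel. x \<in> Iv d \<longrightarrow> ((\<lambda>t. ln (h t)) has_real_derivative (- g x)) (at x)"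
      and aff: "\<exists>\<alpha> \<beta>. \<forall>x\<in>{a..b}. h x = \<alpha> * x + \<beta>"
      and sub: "Iv (pi / 4) \<subseteq> {a..b}" "{a..b} \<subseteq> Iv d"
    obtain \<alpha> \<beta>' where aff': "\<And>x. x \<in> {a..b} \<Longrightarrow> h x = \<alpha> * x + \<beta>'" using aff by blast
    define X where "X = (1 - min (h a) (h b) / max (h a) (h b))\<^sup>2"
    define \<beta> where "\<beta> = X / (32 * pi)"
    have "0 \<in> Iv (pi / 4)" by (simp add: Iv_def)
    then have "0 \<in> {a..b}" using sub(1) by blast
    then have "a \<in> {a..b}" "b \<in> {a..b}" by auto
    then have hab: "h a > 0" "h b > 0" using hpos sub(2) by blast+
    have X: "0 \<le> X" "X \<le> 1"
    proof -
      have "0 \<le> min (h a) (h b) / max (h a) (h b)" "min (h a) (h b) / max (h a) (h b) \<le> 1"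
        using hab by (auto simp: min_def max_def)
      then show "X \<le> 1" unfolding X_def by (intro power_le_one) auto
    qed (simp add: X_def)
    have "X \<le> 32 * pi" using X(2) pi_gt3 by linarith
    then have \<beta>: "0 \<le> \<beta>" "\<beta> \<le> 1" using X(1) by (auto simp: \<beta>_def)
    have "\<bar>\<psi> x\<bar> \<noteq> \<infinity> \<longleftrightarrow> \<bar>f x\<bar> \<noteq> \<infinity>" if "x \<in> Iv pi" for x
      using \<psi>f that by (cases "f x") auto
    then have dom: "fin_dom \<psi> = Iv d" unfolding domf[symmetric] fin_dom_def
      by (intro Collect_cong conj_cong refl)
    have p_eq: "real_of_ereal (\<psi> x) = real_of_ereal (f x) + g x / 2" if "x \<in> Iv d" for x
    proof -
      have "x \<in> Iv pi" "\<bar>f x\<bar> \<noteq> \<infinity>" using that unfolding domf[symmetric] fin_dom_def by auto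
      then show ?thesis using \<psi>f by (cases "f x") auto
    qed
    have mono: "mono_on (Iv d) (\<lambda>x. real_of_ereal (\<psi> x))"
      using class_A_real(2)[OF \<psi> dom] by (intro mono_onI) (metis order_le_less order_refl)
    have hpos': "0 < h x" if "x \<in> Iv d" for x using hpos that by blast
    have lnc: "concave_on (Iv d) (\<lambda>x. ln (h x))"
      using hpos' hc m by (rule concave_on_ln_of_root_concave)
    have "lambda1 (Iv d) q \<ge> ereal (3 + exp (- (6 * pi)) * \<beta>)"
    proof (rule lambda1_ge_of_jump[OF d \<psi> dom pot \<beta>])
      fix x y assume xy: "x \<in> Iv d" "y \<in> Iv d" "pi / 2 < y - x"
      show "2 * tan ((y - x) / 2) + \<beta> \<le> real_of_ereal (\<psi> y) - real_of_ereal (\<psi> x)"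
      proof (rule separation_of_AE[OF d(2) mono p_eq class_A_real(1)[OF f domf] hg _ xy])
        fix x y assume "x \<in> Iv d" "y \<in> Iv d" "pi / 2 < y - x"
          "((\<lambda>t. ln (h t)) has_real_derivative - g x) (at x)" "((\<lambda>t. ln (h t)) has_real_derivative - g y) (at y)"
        from log_derivative_gap[OF d(2) hpos' lnc aff' sub this]
        show "2 * \<beta> \<le> g y - g x" unfolding X_def[symmetric] by (simp add: \<beta>_def)
      qed
    qed
    moreover have "8 * K / (real m * pi\<^sup>2) * X \<le> exp (- (6 * pi)) * \<beta>"
    proof -
      have "8 * K / (real m * pi\<^sup>2) \<le> 8 * K / (1 * pi\<^sup>2)"
        using K m by (intro divide_left_mono mult_right_mono mult_pos_pos) auto
      then have "8 * K / (real m * pi\<^sup>2) * X \<le> 8 * K / (1 * pi\<^sup>2) * X" using X(1) by (rule mult_right_mono)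
      also have "\<dots> = exp (- (6 * pi)) * \<beta>" by (simp add: K_def \<beta>_def power2_eq_square)
      finally show ?thesis .
    qed
    ultimately show "lambda1 (Iv d) q \<ge>
          ereal (3 + 8 * K / (real m * pi\<^sup>2) * (1 - min (h a) (h b) / max (h a) (h b))\<^sup>2)"
      unfolding X_def[symmetric] by (meson add_left_mono ereal_less_eq(3) order_trans)
  qed
qed

end
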